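(* Let $p=(p_1,\dots,p_n)\in\mathbb{Z}_+^n$ be fixed with at least one $p_k=0$, and let $\mathbf{s}=\{s_{i_1,\dots,i_n}\}$ be a sequence of real numbers such that $s_{i_1,\dots,i_n}=0$ unless $(i_1,\dots,i_n)=(p_1+j,\dots,p_n+j)$ for some $j\ge 0$. Let $\mathfrak{s}=\{\mathfrak{s}_i\}_{i=0}^{2\mu_N-1}$ be the $d_p$-associated sequence of $\mathbf{s}$ and let $\mathcal{N}(\mathfrak{s})=\{\nu_j\}_{j=1}^N\cup\{\mu_j\}_{j=1}^{N}$ be its set of normal indices. Then any solution $F_{d_p}$ of the $d_p$-diagonal truncated problem $\mathbf{MP}(\mathbf{s},2\mu_N-1)$ admits the representation $$F_{d_p}(z_1,\dots,z_n)=\frac{1}{\prod_{i=1}^n z_i^{p_i}}\cdot\cfrac{1}{-m_1 z+\cfrac{1}{l_1+\cdots+\cfrac{1}{-m_N z+\cfrac{1}{l_N+\tau(z_1,\dots,z_n)}}}},\qquad z=\prod_{i=1}^n z_i,$$ where the parameter $\tau$ satisfies $\tau(z_1,\dots,z_n)=o(1)$ as all $z_i\widehat\to\infty$, and the atoms $m_j=m_j(z_1,\dots,z_n)$, $l_j=l_j(z_1,\dots,z_n)$ are given by the determinant formulas and recurrences in the context (with $\ell=2\mu_N-1$).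
   Context: Notation: $z=\prod_{i=1}^n z_i$; $z_i\widehat\to\infty$ means $z_i\to\infty$ inside a sector $\varepsilon<\arg z_i<\pi-\varepsilon$, $\varepsilon>0$. The $d_p$-associated sequence of $\mathbf{s}$ is $\mathfrak{s}_j=\binom{jn+\sum_k p_k}{p_1+j,\dots,p_n+j}s_{p_1+j,\dots,p_n+j}$, $0\le j\le\ell$. The $d_p$-diagonal truncated problem $\mathbf{MP}(\mathbf{s},\ell)$ is to describe the functions $F_{d_p}$ (solutions) such that, as all $z_i\widehat\to\infty$, $$F_{d_p}(z_1,\dots,z_n)=\frac{1}{\prod_i z_i^{p_i}}\Big(-\frac{\mathfrak{s}_0}{z}-\dots-\frac{\mathfrak{s}_\ell}{z^{\ell+1}}+o\Big(\frac1{z^{\ell+1}}\Big)\Big).$$ Normal indices: $D_k=\det(\mathfrak{s}_{i+j})_{i,j=0}^{k-1}$, $D_k^+=\det(\mathfrak{s}_{i+j+1})_{i,j=0}^{k-1}$, $D_0=D_0^+=1$. $\mathcal{N}(\mathfrak{s})$ is the set of $k\ge1$ with $D_k\ne0$; the $\nu_j$ are, in increasing order, those with $D_{\nu_j}\neq0,\ D^+_{\nu_j-1}\ne0$, and the $\mu_j$ those with $D_{\mu_j}\ne0,\ D^+_{\mu_j}\ne0$; one has $0<\nu_1\le\mu_1<\nu_2\le\mu_2<\dots$. Put $\mu_0=0$. Atoms. $T(c_0,\dots,c_r)$ is the $(r+1)\times(r+1)$ upper triangular Toeplitz matrix with entries $c_{k-i}$ ($k\ge i$). Set $\mathfrak{s}^{(1)}=\mathfrak{s}$;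 for each $j$ put $\nu=\nu_j-\mu_{j-1}$, $\mu=\mu_j-\nu_j$, $\ell_j=\ell-2\mu_{j-1}$, and let $D^{(k)}_r$, $D^{(k)+}_r$ be the determinants $D_r,D_r^+$ formed from $\mathfrak{s}^{(k)}$. Given $\{\mathfrak{s}^{(2j-1)}_i\}_{i=0}^{\ell_j}$, $$m_j=\frac{(-1)^{\nu+1}}{D^{(2j-1)}_\nu}\begin{vmatrix}0&\cdots&0&\mathfrak{s}^{(2j-1)}_{\nu-1}&\mathfrak{s}^{(2j-1)}_{\nu}\\ \vdots&&&&\vdots\\ \mathfrak{s}^{(2j-1)}_{\nu-1}&\mathfrak{s}^{(2j-1)}_{\nu}&\cdots&\cdots&\mathfrak{s}^{(2j-1)}_{2\nu-2}\\1&z&\cdots&z^{\nu-2}&z^{\nu-1}\end{vmatrix}=\sum_{i=0}^{\nu-1}m^{(j)}_iz^i ;$$ $\{\mathfrak{s}^{(2j)}_i\}_{i=-1}^{\ell_j-2\nu}$ is defined by $T(m^{(j)}_{\nu-1},\dots,m^{(j)}_0,-\mathfrak{s}^{(2j)}_{-1},\dots,-\mathfrak{s}^{(2j)}_{\ell_j-2\nu})\,T(\mathfrak{s}^{(2j-1)}_{\nu-1},\dots,\mathfrak{s}^{(2j-1)}_{\ell_j})=I_{\ell_j-\nu+2}$; $$l_j=\frac{1}{\mathfrak{s}^{(2j)}_{-1}}=(-1)^{\nu+1}\mathfrak{s}^{(2j-1)}_{\nu-1}\frac{D^{(2j-1)}_\nu}{D^{(2j-1)+}_\nu}\ \text{ if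 }\nu_j=\mu_j,\qquad l_j=\frac{1}{\mathfrak{s}^{(2j)}_{\mu-1}D^{(2j)}_\mu}\begin{vmatrix}\mathfrak{s}^{(2j)}_0&\cdots&\mathfrak{s}^{(2j)}_\mu\\ \vdots&&\vdots\\ \mathfrak{s}^{(2j)}_{\mu-1}&\cdots&\mathfrak{s}^{(2j)}_{2\mu-1}\\1&\cdots&z^\mu\end{vmatrix}\ \text{ if }\nu_j<\mu_j ;$$ with $l_j=\sum_{i=0}^{\mu}l^{(j)}_iz^i$, $\{\mathfrak{s}^{(2j+1)}_i\}_{i=0}^{\ell-2\mu_j}$ is defined (for $j<N$) by $T(l^{(j)}_{\mu},\dots,l^{(j)}_0,-\mathfrak{s}^{(2j+1)}_0,\dots,-\mathfrak{s}^{(2j+1)}_{\ell-2\mu_j})\,T(\mathfrak{s}^{(2j)}_{\mu-1},\dots,\mathfrak{s}^{(2j)}_{\ell_j-2\nu})=I_{\ell-\mu_j-\nu_j+2}$. *)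

theory Defs
  imports
    Complex_Main
    "HOL-Library.Cardinality"
    "HOL-Library.Landau_Symbols"
    "HOL-Computational_Algebra.Polynomial"
    "Jordan_Normal_Form.Determinant"
begin

text \<open>
  Points of \<open>n\<close>-dimensional complex space and multi-indices are functions on a finite index
  type \<open>'n\<close>, so that \<open>n = CARD('n)\<close>.
\<close>

text \<open>All coordinates tend to infinity, independently of each other, inside the sector
  \<open>\<epsilon> < arg w < \<pi> - \<epsilon>\<close>.\<close>

definition at_infinity_sector :: "real \<Rightarrow> ('n::finite \<Rightarrow> complex) filter" where
  "at_infinity_sector \<epsilon> =
     (INF i. filtercomap (\<lambda>z. z i)
        (inf at_infinity (principal {w. \<epsilon> < Arg w \<and> Arg w < pi - \<epsilon>})))"

definition associated_seq :: "('n::finite \<Rightarrow> nat) \<Rightarrow> (('n \<Rightarrow> nat) \<Rightarrow> real) \<Rightarrow> nat \<Rightarrow> real" where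
  "associated_seq p s j =
     fact (j * CARD('n) + (\<Sum>k\<in>UNIV. p k)) / (\<Prod>k\<in>UNIV. fact (p k + j)) * s (\<lambda>k. p k + j)"

definition MP_solution ::
    "('n::finite \<Rightarrow> nat) \<Rightarrow> (('n \<Rightarrow> nat) \<Rightarrow> real) \<Rightarrow> nat \<Rightarrow> (('n \<Rightarrow> complex) \<Rightarrow> complex) \<Rightarrow> bool" where
  "MP_solution p s L F \<longleftrightarrow>
     (\<forall>\<epsilon>>0.
        (\<lambda>z. F z - 1 / (\<Prod>i\<in>UNIV. z i ^ p i) *
               (\<Sum>j\<le>L. - complex_of_real (associated_seq p s j) / (\<Prod>i\<in>UNIV. z i) ^ (j + 1)))
        \<in> o[at_infinity_sector \<epsilon>](\<lambda>z. 1 / (\<Prod>i\<in>UNIV. z i ^ p i) * (1 / (\<Prod>i\<in>UNIV. z i) ^ (L + 1))))"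

definition hankel_det :: "(nat \<Rightarrow> real) \<Rightarrow> nat \<Rightarrow> real" where
  "hankel_det a k = det (mat k k (\<lambda>(i, j). a (i + j)))"

definition hankel_det_plus :: "(nat \<Rightarrow> real) \<Rightarrow> nat \<Rightarrow> real" where
  "hankel_det_plus a k = det (mat k k (\<lambda>(i, j). a (i + j + 1)))"

text \<open>
  Normal indices of the truncated sequence \<open>a\<^sub>0, \<dots>, a\<^sub>L\<close>.  A determinant is taken into account only
  if its entries are among these terms: the last entry is \<open>a (2 * k - 2)\<close> for the first
  determinant and \<open>a (2 * k - 1)\<close> for the shifted one.
\<close>

definition normal_indices :: "(nat \<Rightarrow> real) \<Rightarrow> nat \<Rightarrow> nat set" where
  "normal_indices a L = {k. 1 \<le> k \<and> 2 * k - 2 \<le> L \<and> hankel_det a k \<noteq> 0}"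

definition nu_indices :: "(nat \<Rightarrow> real) \<Rightarrow> nat \<Rightarrow> nat set" where
  "nu_indices a L = {k \<in> normal_indices a L. hankel_det_plus a (k - 1) \<noteq> 0}"

definition mu_indices :: "(nat \<Rightarrow> real) \<Rightarrow> nat \<Rightarrow> nat set" where
  "mu_indices a L = {k \<in> normal_indices a L. 2 * k - 1 \<le> L \<and> hankel_det_plus a k \<noteq> 0}"

definition toeplitz :: "real list \<Rightarrow> real mat" where
  "toeplitz cs = mat (length cs) (length cs) (\<lambda>(i, k). if i \<le> k then cs ! (k - i) else 0)"

text \<open>
  The determinant formulas for the atoms, as polynomials in \<open>z\<close>.  The sequence \<open>a\<close> is indexed by
  integers because the sequences of even order start at \<open>-1\<close>; Hankel determinants
  always start at index \<open>0\<close>.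
\<close>

definition m_atom :: "(int \<Rightarrow> real) \<Rightarrow> nat \<Rightarrow> real poly" where
  "m_atom a \<nu> =
     smult ((-1) ^ (\<nu> + 1) / hankel_det (\<lambda>i. a (int i)) \<nu>)
       (det (mat \<nu> \<nu> (\<lambda>(r, c).
          if r = \<nu> - 1 then monom 1 c
          else if r + c + 1 < \<nu> - 1 then 0
          else [: a (int (r + c + 1)) :])))"

definition l_atom :: "(int \<Rightarrow> real) \<Rightarrow> nat \<Rightarrow> real poly" where
  "l_atom a \<mu> =
     smult (1 / (a (int \<mu> - 1) * hankel_det (\<lambda>i. a (int i)) \<mu>))
       (det (mat (\<mu> + 1) (\<mu> + 1) (\<lambda>(r, c).
          if r = \<mu> then monom 1 c else [: a (int (r + c)) :])))"

text \<open>
  \<open>S k\<close> is the \<open>k\<close>-th induced sequence; only its values on the index range occurring below matter.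
  \<open>nu\<close>, \<open>mu\<close> enumerate the normal indices (with \<open>mu 0 = 0\<close>); at step \<open>j\<close>, \<open>\<nu>\<close>, \<open>\<mu>\<close> are their
  increments and \<open>Lj\<close> is the last index of \<open>S (2 * j - 1)\<close>.  The sequence \<open>S (2 * j)\<close> has
  the index range \<open>-1, \<dots>, Lj - 2 * \<nu>\<close>.
\<close>

definition atom_recurrence ::
    "nat \<Rightarrow> nat \<Rightarrow> (nat \<Rightarrow> nat) \<Rightarrow> (nat \<Rightarrow> nat) \<Rightarrow> (nat \<Rightarrow> real)
     \<Rightarrow> (nat \<Rightarrow> int \<Rightarrow> real) \<Rightarrow> (nat \<Rightarrow> real poly) \<Rightarrow> (nat \<Rightarrow> real poly) \<Rightarrow> bool" where
  "atom_recurrence L N nu mu \<s> S m l \<longleftrightarrow>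
     (\<forall>i\<le>L. S 1 (int i) = \<s> i) \<and>
     (\<forall>j\<in>{1..N}.
        let \<nu> = nu j - mu (j - 1);
            \<mu> = mu j - nu j;
            Lj = int L - 2 * int (mu (j - 1))
        in
          m j = m_atom (S (2 * j - 1)) \<nu> \<and>
          toeplitz (map (coeff (m j)) (rev [0..<\<nu>]) @ map (\<lambda>i. - S (2 * j) i) [-1..Lj - 2 * int \<nu>])
            * toeplitz (map (S (2 * j - 1)) [int \<nu> - 1..Lj])
            = 1\<^sub>m (nat (Lj - int \<nu> + 2)) \<and>
          (nu j = mu j \<longrightarrow>
             l j = [: 1 / S (2 * j) (-1) :] \<and>
             l j = [: (-1) ^ (\<nu> + 1) * S (2 * j - 1) (int \<nu> - 1)
                       * hankel_det (\<lambda>i. S (2 * j - 1) (int i)) \<nu>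
                       / hankel_det_plus (\<lambda>i. S (2 * j - 1) (int i)) \<nu> :]) \<and>
          (nu j < mu j \<longrightarrow> l j = l_atom (S (2 * j)) \<mu>) \<and>
          (j < N \<longrightarrow>
             toeplitz (map (coeff (l j)) (rev [0..<\<mu> + 1])
                         @ map (\<lambda>i. - S (2 * j + 1) i) [0..int L - 2 * int (mu j)])
               * toeplitz (map (S (2 * j)) [int \<mu> - 1..Lj - 2 * int \<nu>])
               = 1\<^sub>m (nat (int L - int (mu j) - int (nu j) + 2))))"

definition atom_at :: "real poly \<Rightarrow> ('n::finite \<Rightarrow> complex) \<Rightarrow> complex" where
  "atom_at q z = poly (map_poly complex_of_real q) (\<Prod>i\<in>UNIV. z i)"

text \<open>
  The part of the continued fraction from level \<open>j\<close> on:
  \<open>1 / (- m\<^sub>j z + 1 / (l\<^sub>j + 1 / (- m\<^sub>j\<^sub>+\<^sub>1 z + \<dots> 1 / (l\<^sub>N + t))))\<close>, and \<open>t\<close> for \<open>j = N + 1\<close>.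
\<close>

definition cfrac_from ::
    "(nat \<Rightarrow> real poly) \<Rightarrow> (nat \<Rightarrow> real poly) \<Rightarrow> nat \<Rightarrow> ('n::finite \<Rightarrow> complex) \<Rightarrow> complex \<Rightarrow> nat \<Rightarrow> complex"
  where
  "cfrac_from m l N z t j =
     foldr (\<lambda>k x. 1 / (- atom_at (m k) z * (\<Prod>i\<in>UNIV. z i) + 1 / (atom_at (l k) z + x)))
       [j..<N + 1] t"

text \<open>No denominator vanishes, i.e. the value above does not involve division by zero.\<close>

definition cfrac_regular ::
    "(nat \<Rightarrow> real poly) \<Rightarrow> (nat \<Rightarrow> real poly) \<Rightarrow> nat \<Rightarrow> ('n::finite \<Rightarrow> complex) \<Rightarrow> complex \<Rightarrow> bool" where
  "cfrac_regular m l N z t \<longleftrightarrow>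
     (\<forall>j\<in>{1..N}.
        atom_at (l j) z + cfrac_from m l N z t (j + 1) \<noteq> 0 \<and>
        - atom_at (m j) z * (\<Prod>i\<in>UNIV. z i)
          + 1 / (atom_at (l j) z + cfrac_from m l N z t (j + 1)) \<noteq> 0)"

end

theory Submission
  imports Defs "HOL-Computational_Algebra.Formal_Power_Series"
begin

text \<open>
  With \<open>f = \<Sum> x\<^sub>i w\<^sup>i\<close>, \<open>w = 1 / z\<close>, and \<open>x\<^sub>n\<close> the first nonzero coefficient, inversion of power series gives
  \<open>1 / f = q(z) - \<Sum> y\<^sub>i w\<^sup>i\<^sup>+\<^sup>1\<close> with \<open>deg q = n\<close>.  Both kinds of steps of the recurrence are of this form
  (for the even sequences after shifting the index by one): the atoms are the polynomial parts \<open>q\<close>,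
  the next sequence is \<open>y\<close>.  By Jacobi's identity for complementary minors, the Hankel determinants
  of \<open>x\<close> of order \<open>n + 1 + k\<close> and the shifted ones of order \<open>n + k\<close> agree, up to nonzero factors, with
  the shifted ones of \<open>y\<close> of order \<open>k\<close> and the unshifted ones of order \<open>k\<close>.  Hence the positions of the
  first nonzero terms of all induced sequences are the gaps between normal indices.  A solution
  is expanded by inverting its asymptotic expansion step by step; the last remainder is \<open>\<tau>\<close>.
\<close>

section \<open>Complementary minors of Toeplitz matrices\<close>

text \<open>This is an entry of a product of two triangular Toeplitz matrices: only the indices
  \<open>t\<close> between \<open>c\<close> and \<open>i\<close> contribute, which leaves a
  coefficient of the product of the generating series.\<close>

lemma sum_shifted_convolution:
  fixes f g :: "nat \<Rightarrow> 'a::comm_semiring_0"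
  assumes "i < m"
  shows "(\<Sum>t<m. (if c \<le> t then f (t - c) else 0) * (if t \<le> i then g (i - t) else 0)) =
    (if c \<le> i then \<Sum>d\<le>i - c. f d * g (i - c - d) else 0)"
proof -
  have "(\<Sum>t<m. (if c \<le> t then f (t - c) else 0) * (if t \<le> i then g (i - t) else 0)) =
    (\<Sum>t\<in>{c..i}. f (t - c) * g (i - t))"
    using assms by (intro sum.mono_neutral_cong_right) auto
  also have "\<dots> = (if c \<le> i then \<Sum>d\<le>i - c. f d * g (i - c - d) else 0)"
  proof (cases "c \<le> i")
    case True
    have "(\<Sum>t\<in>{c..i}. f (t - c) * g (i - t)) = (\<Sum>d\<le>i - c. f d * g (i - c - d))"
      using True
      by (intro sum.reindex_bij_witness[where i = "\<lambda>d. d + c" and j = "\<lambda>t. t - c"]) auto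
    then show ?thesis using True by simp
  qed simp
  finally show ?thesis .
qed

lemma det_reverse_cols:
  fixes f :: "nat \<Rightarrow> nat \<Rightarrow> 'a::idom"
  shows "det (mat n n (\<lambda>(i, j). f i (n - 1 - j))) \<noteq> 0 \<longleftrightarrow> det (mat n n (\<lambda>(i, j). f i j)) \<noteq> 0"
proof -
  \<comment> \<open>\<open>J\<close> is the exchange matrix. As it is an involution, its determinant
    is nonzero; the sign stays undetermined.\<close>
  define J :: "'a mat" where "J = mat n n (\<lambda>(i, j). if i = n - 1 - j then 1 else 0)"
  have J: "J \<in> carrier_mat n n" by (simp add: J_def)
  have mult: "mat n n (\<lambda>(i, j). g i j) * J = mat n n (\<lambda>(i, j). g i (n - 1 - j))"
    for g :: "nat \<Rightarrow> nat \<Rightarrow> 'a"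
    by (intro eq_matI) (auto simp: J_def scalar_prod_def if_distrib sum.delta cong: if_cong)
  have "det (mat n n (\<lambda>(i, j). f i (n - 1 - j))) = det (mat n n (\<lambda>(i, j). f i j)) * det J"
    unfolding mult[symmetric] by (rule det_mult[OF _ J]) simp
  moreover have "det (J * J) = 1"
  proof -
    have "J * J = 1\<^sub>m n"
      unfolding J_def mult[of "\<lambda>i j. if i = n - 1 - j then 1 else 0", unfolded J_def]
      by (intro eq_matI) auto
    then show ?thesis by simp
  qed
  then have "det J \<noteq> 0" using det_mult[OF J J] by auto
  ultimately show ?thesis by simp
qed

text \<open>Jacobi's identity for complementary minors of a triangular Toeplitz matrix and its inverse,
  as far as vanishing is concerned.\<close>

lemma det_toeplitz_complementary_minor:
  fixes u :: "'a::field fps"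
  assumes u0: "fps_nth u 0 \<noteq> 0"
  shows "det (mat (n + k) (n + k) (\<lambda>(i, j). if j \<le> i + k then fps_nth u (i + k - j) else 0)) \<noteq> 0 \<longleftrightarrow>
    det (mat k k (\<lambda>(i, j). fps_nth (inverse u) (n + k + i - j))) \<noteq> 0"
proof -
  define v where "v = inverse u"
  define N where "N = n + k"
  define m where "m = N + k"
  define U where "U = mat m m (\<lambda>(i, j). if j \<le> i then fps_nth u (i - j) else 0)"
  \<comment> \<open>The first \<open>N\<close> columns of \<open>X\<close> are unit vectors and the
    last \<open>k\<close> are the first \<open>k\<close> columns of the inverse of \<open>U\<close>.
    Hence \<open>U * X\<close> consists of the first \<open>N\<close> columns of \<open>U\<close>
    followed by the first \<open>k\<close> unit vectors, while \<open>det X = det G\<close>.\<close>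
  define X where "X = mat m m (\<lambda>(i, j). if j < N then (if i = j then 1 else 0)
    else if j - N \<le> i then fps_nth v (i - (j - N)) else 0)"
  define H where "H = mat N N (\<lambda>(i, j). if j \<le> i + k then fps_nth u (i + k - j) else 0)"
  define G where "G = mat k k (\<lambda>(i, j). fps_nth v (N + i - j))"
  have [simp]: "U \<in> carrier_mat m m" "X \<in> carrier_mat m m" "H \<in> carrier_mat N N"
    "G \<in> carrier_mat k k" "k \<le> N"
    by (simp_all add: U_def X_def H_def G_def N_def)
  have vu: "(\<Sum>d\<le>r. fps_nth v d * fps_nth u (r - d)) = (if r = 0 then 1 else 0)" for r
    using inverse_mult_eq_1[OF u0] by (metis v_def fps_mult_nth fps_one_nth atLeast0AtMost)
  have "det U = prod_list (diag_mat U)"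
    by (rule det_lower_triangular[where n = m]) (auto simp: U_def)
  also have "diag_mat U = replicate m (fps_nth u 0)"
    by (intro nth_equalityI) (auto simp: diag_mat_def U_def)
  finally have detU: "det U \<noteq> 0" using u0 by simp
  have "X = four_block_mat (1\<^sub>m N) (mat N k (\<lambda>(i, j). X $$ (i, j + N))) (0\<^sub>m k N) G"
    by (intro eq_matI) (auto simp: X_def G_def m_def N_def)
  then have detX: "det X = det G"
    by (metis (no_types, lifting) det_four_block_mat_lower_left_zero det_one mult_1 one_carrier_mat
        mat_carrier \<open>G \<in> carrier_mat k k\<close>)
  have entry: "(U * X) $$ (i, j) = (if j < N then U $$ (i, j) else if i = j - N then 1 else 0)"
    if "i < m" "j < m" for i j
  proof (cases "j < N")
    case True
    have "(U * X) $$ (i, j) = (\<Sum>t<m. if t = j then U $$ (i, j) else 0)"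
    proof -
      have "(U * X) $$ (i, j) = (\<Sum>t<m. U $$ (i, t) * X $$ (t, j))"
        using that by (simp add: U_def X_def scalar_prod_def atLeast0LessThan)
      also have "\<dots> = (\<Sum>t<m. if t = j then U $$ (i, j) else 0)"
      proof (rule sum.cong)
        fix t assume "t \<in> {..<m}"
        then have "X $$ (t, j) = (if t = j then 1 else 0)" using that True by (simp add: X_def)
        then show "U $$ (i, t) * X $$ (t, j) = (if t = j then U $$ (i, j) else 0)" by simp
      qed simp
      finally show ?thesis .
    qed
    then show ?thesis using that True by simp
  next
    case False
    have "(U * X) $$ (i, j) = (\<Sum>t<m. (if j - N \<le> t then fps_nth v (t - (j - N)) else 0) *
        (if t \<le> i then fps_nth u (i - t) else 0))"
      using that False
      by (auto simp: U_def X_def scalar_prod_def atLeast0LessThan mult.commute intro!: sum.cong)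
    then show ?thesis
      unfolding sum_shifted_convolution[OF that(1)] vu using False by auto
  qed
  have UX: "U * X \<in> carrier_mat m m" by (rule mult_carrier_mat[of _ m m]) simp_all
  \<comment> \<open>Moving the last \<open>k\<close> columns to the front makes the product block
    triangular with diagonal blocks the identity and \<open>H\<close>, so \<open>det G\<close> and
    \<open>det H\<close> differ only by a sign and the factor \<open>det U\<close>.\<close>
  have "det (U * X) = (- 1) ^ (N * k) * det (mat m m (\<lambda>(i, j). (U * X) $$
      (i, if j < k then j + N else if j < N + k then j - k else j)))"
    by (rule det_swap_initial_cols[OF UX]) (simp add: m_def)
  also have "mat m m (\<lambda>(i, j). (U * X) $$
      (i, if j < k then j + N else if j < N + k then j - k else j)) =
    four_block_mat (1\<^sub>m k) (mat k N (\<lambda>(i, j). U $$ (i, j))) (0\<^sub>m N k) H"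
    (is "?L = ?R")
  proof (rule eq_matI)
    fix i j assume "i < dim_row ?R" "j < dim_col ?R"
    then have ij: "i < N + k" "j < N + k" by (simp_all add: H_def add.commute)
    show "?L $$ (i, j) = ?R $$ (i, j)"
    proof (cases "j < k")
      case True
      then have "?L $$ (i, j) = (U * X) $$ (i, j + N)" using ij by (simp add: m_def)
      then show ?thesis using ij True entry[of i "j + N"] by (auto simp: m_def H_def)
    next
      case False
      then have "?L $$ (i, j) = (U * X) $$ (i, j - k)" using ij by (simp add: m_def)
      also have "\<dots> = U $$ (i, j - k)" using ij False entry[of i "j - k"] by (auto simp: m_def)
      also have "\<dots> = ?R $$ (i, j)" using ij False by (auto simp: U_def H_def m_def)
      finally show ?thesis .
    qed
  qed (auto simp: m_def H_def)
  also have "det \<dots> = det H"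
    by (subst det_four_block_mat_lower_left_zero[where n = k and m = N]) auto
  finally have "det U * det X = (- 1) ^ (N * k) * det H"
    by (simp add: det_mult[where n = m])
  then have "det H \<noteq> 0 \<longleftrightarrow> det G \<noteq> 0"
    using detU detX by auto
  then show ?thesis
    by (simp add: H_def G_def N_def v_def)
qed

section \<open>Hankel determinants and atoms\<close>

text \<open>For \<open>x n \<noteq> 0\<close> this is the reciprocal of the series of
  \<open>x\<close> stripped of its first \<open>n\<close> terms; if those terms vanish, it is
  \<open>w^n / f\<close> in the notation of the overview.\<close>

definition tail_inverse :: "nat \<Rightarrow> (nat \<Rightarrow> real) \<Rightarrow> real fps" where
  "tail_inverse n x = inverse (Abs_fps (\<lambda>k. x (n + k)))"

text \<open>Multiplying by \<open>z^n\<close> turns the \<open>k\<close>-th term of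
  \<open>tail_inverse n x\<close> into a multiple of \<open>z^(n - k)\<close>. The indices
  \<open>k \<le> n\<close> give this polynomial part; the later ones, with opposite sign, give
  \<open>next_seq\<close>.\<close>

definition quot_poly :: "nat \<Rightarrow> (nat \<Rightarrow> real) \<Rightarrow> real poly" where
  "quot_poly n x = (\<Sum>c\<le>n. monom (fps_nth (tail_inverse n x) (n - c)) c)"

definition next_seq :: "nat \<Rightarrow> (nat \<Rightarrow> real) \<Rightarrow> nat \<Rightarrow> real" where
  "next_seq n x i = - fps_nth (tail_inverse n x) (n + 1 + i)"

definition first_nonzero :: "(nat \<Rightarrow> real) \<Rightarrow> nat \<Rightarrow> bool" where
  "first_nonzero x n \<longleftrightarrow> (\<forall>i<n. x i = 0) \<and> x n \<noteq> 0"

lemma coeff_quot_poly: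
  "coeff (quot_poly n x) c = (if c \<le> n then fps_nth (tail_inverse n x) (n - c) else 0)"
  by (auto simp: quot_poly_def coeff_sum if_distrib cong: if_cong)

lemma tail_inverse_convolution:
  assumes "x n \<noteq> 0"
  shows "(\<Sum>d\<le>r. fps_nth (tail_inverse n x) d * x (n + (r - d))) = (if r = 0 then 1 else 0)"
proof -
  have "tail_inverse n x * Abs_fps (\<lambda>k. x (n + k)) = 1"
    unfolding tail_inverse_def by (rule inverse_mult_eq_1) (simp add: assms)
  then show ?thesis
    by (metis (no_types, lifting) fps_mult_nth fps_one_nth atLeast0AtMost fps_nth_Abs_fps sum.cong)
qed

lemma tail_inverse_0: "x n \<noteq> 0 \<Longrightarrow> fps_nth (tail_inverse n x) 0 = 1 / x n"
  by (simp add: tail_inverse_def divide_inverse)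

text \<open>The system is triangular: equation \<open>r\<close> determines \<open>y r\<close> from
  the earlier terms because \<open>x n\<close> is nonzero. The bound \<open>R\<close> is there
  because the recurrence fixes only finitely many terms.\<close>

lemma tail_inverse_unique:
  assumes "x n \<noteq> 0"
  shows "(\<forall>r<R. (\<Sum>d\<le>r. y d * x (n + (r - d))) = (if r = 0 then 1 else 0)) \<longleftrightarrow>
    (\<forall>r<R. y r = fps_nth (tail_inverse n x) r)"
proof
  assume y: "\<forall>r<R. (\<Sum>d\<le>r. y d * x (n + (r - d))) = (if r = 0 then 1 else 0)"
  show "\<forall>r<R. y r = fps_nth (tail_inverse n x) r"
  proof (intro allI impI)
    fix r assume "r < R"
    then show "y r = fps_nth (tail_inverse n x) r"
    proof (induction r rule: less_induct)
      case (less r)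
      have "(\<Sum>d<r. y d * x (n + (r - d))) = (\<Sum>d<r. fps_nth (tail_inverse n x) d * x (n + (r - d)))"
        using less by (intro sum.cong) auto
      moreover have "(\<Sum>d\<le>r. y d * x (n + (r - d))) =
          (\<Sum>d\<le>r. fps_nth (tail_inverse n x) d * x (n + (r - d)))"
        unfolding tail_inverse_convolution[of x n r, OF assms] using y less.prems by blast
      ultimately show ?case
        using assms by (simp add: lessThan_Suc_atMost[symmetric])
    qed
  qed
next
  assume y: "\<forall>r<R. y r = fps_nth (tail_inverse n x) r"
  show "\<forall>r<R. (\<Sum>d\<le>r. y d * x (n + (r - d))) = (if r = 0 then 1 else 0)"
  proof (intro allI impI)
    fix r assume "r < R"
    then have "(\<Sum>d\<le>r. y d * x (n + (r - d))) =
        (\<Sum>d\<le>r. fps_nth (tail_inverse n x) d * x (n + (r - d)))"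
      using y by (intro sum.cong) auto
    then show "(\<Sum>d\<le>r. y d * x (n + (r - d))) = (if r = 0 then 1 else 0)"
      using tail_inverse_convolution[of x n r, OF assms] by simp
  qed
qed

section \<open>Hankel determinants of a sequence and of its successor\<close>

lemma hankel_det_plus_shift: "hankel_det_plus x k = hankel_det (\<lambda>i. x (Suc i)) k"
  by (simp add: hankel_det_def hankel_det_plus_def)

lemma hankel_det_0 [simp]: "hankel_det x 0 = 1" "hankel_det_plus x 0 = 1"
  by (simp_all add: hankel_det_def hankel_det_plus_def)

lemma hankel_det_cong:
  "(\<And>i. i + 1 < 2 * k \<Longrightarrow> x i = y i) \<Longrightarrow> hankel_det x k = hankel_det y k"
  unfolding hankel_det_def by (intro arg_cong[where f = det] eq_matI) auto

lemma hankel_det_plus_cong: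
  "(\<And>i. i < 2 * k \<Longrightarrow> x i = y i) \<Longrightarrow> hankel_det_plus x k = hankel_det_plus y k"
  unfolding hankel_det_plus_def by (intro arg_cong[where f = det] eq_matI) auto

text \<open>The first row of the matrix is zero.\<close>

lemma hankel_det_eq_0:
  assumes "k \<noteq> 0" "\<And>i. i < k \<Longrightarrow> x i = 0"
  shows "hankel_det x k = 0"
proof -
  have "det (mat k k (\<lambda>(i, j). x (i + j))) = (\<Sum>j<k. 0)"
    using assms
    by (subst laplace_expansion_row[of _ k 0]) (auto intro!: sum.neutral)
  then show ?thesis by (simp add: hankel_det_def)
qed

text \<open>Reversing the columns turns a Hankel matrix into a Toeplitz matrix.\<close>

lemma hankel_det_complementary_minor:
  fixes u :: "real fps"
  assumes "fps_nth u 0 \<noteq> 0"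
  shows "hankel_det (\<lambda>i. if i + 1 < n then 0 else fps_nth u (i + 1 - n)) (n + k) \<noteq> 0 \<longleftrightarrow>
    hankel_det (\<lambda>i. fps_nth (inverse u) (n + 1 + i)) k \<noteq> 0"
proof -
  \<comment> \<open>For positive \<open>n\<close> this is \<open>u\<close> behind
    \<open>n - 1\<close> zeros. For \<open>n = 0\<close> it is \<open>u\<close> without its constant
    term, the form of a shifted sequence whose unshifted first term is nonzero.\<close>
  let ?h = "\<lambda>i. if i + 1 < n then 0 else fps_nth u (i + 1 - n)"
  have "hankel_det ?h (n + k) \<noteq> 0 \<longleftrightarrow>
      det (mat (n + k) (n + k) (\<lambda>(i, j). ?h (i + (n + k - 1 - j)))) \<noteq> 0"
    unfolding hankel_det_def by (rule det_reverse_cols[symmetric])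
  also have "mat (n + k) (n + k) (\<lambda>(i, j). ?h (i + (n + k - 1 - j))) =
      mat (n + k) (n + k) (\<lambda>(i, j). if j \<le> i + k then fps_nth u (i + k - j) else 0)"
    by (intro eq_matI) auto
  also have "det \<dots> \<noteq> 0 \<longleftrightarrow> det (mat k k (\<lambda>(i, j). fps_nth (inverse u) (n + k + i - j))) \<noteq> 0"
    by (rule det_toeplitz_complementary_minor[OF assms])
  also have "\<dots> \<longleftrightarrow> det (mat k k (\<lambda>(i, j). fps_nth (inverse u) (n + k + i - (k - 1 - j)))) \<noteq> 0"
    by (rule det_reverse_cols[symmetric])
  also have "mat k k (\<lambda>(i, j). fps_nth (inverse u) (n + k + i - (k - 1 - j))) =
      mat k k (\<lambda>(i, j). fps_nth (inverse u) (n + 1 + (i + j)))"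
    by (intro eq_matI) (auto intro!: arg_cong[where f = "fps_nth (inverse u)"])
  finally show ?thesis by (simp add: hankel_det_def)
qed

lemma hankel_det_uminus: "hankel_det (\<lambda>i. - x i) k \<noteq> 0 \<longleftrightarrow> hankel_det x k \<noteq> 0"
proof -
  have "mat k k (\<lambda>(i, j). - x (i + j)) = (-1) \<cdot>\<^sub>m mat k k (\<lambda>(i, j). x (i + j))"
    by (intro eq_matI) auto
  then show ?thesis by (simp add: hankel_det_def)
qed

text \<open>The complementary minors are applied to \<open>x\<close> itself, with parameter
  \<open>n + 1\<close>, and to its shift, with parameter \<open>n\<close>. The resulting minors of
  the inverse start at the coefficients \<open>n + 2\<close> and \<open>n + 1\<close>, which is why
  plain and shifted determinants change roles.\<close>

lemma hankel_det_next_seq: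
  assumes "first_nonzero x n"
  shows "hankel_det x (n + 1 + k) \<noteq> 0 \<longleftrightarrow> hankel_det_plus (next_seq n x) k \<noteq> 0"
    and "hankel_det_plus x (n + k) \<noteq> 0 \<longleftrightarrow> hankel_det (next_seq n x) k \<noteq> 0"
proof -
  let ?u = "Abs_fps (\<lambda>k. x (n + k))"
  have u0: "fps_nth ?u 0 \<noteq> 0" using assms by (simp add: first_nonzero_def)
  have "hankel_det x (n + 1 + k) =
      hankel_det (\<lambda>i. if i + 1 < n + 1 then 0 else fps_nth ?u (i + 1 - (n + 1))) (n + 1 + k)"
    using assms by (intro hankel_det_cong) (auto simp: first_nonzero_def)
  then have "hankel_det x (n + 1 + k) \<noteq> 0 \<longleftrightarrow>
      hankel_det (\<lambda>i. fps_nth (inverse ?u) (n + 1 + 1 + i)) k \<noteq> 0"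
    using hankel_det_complementary_minor[OF u0, of "n + 1" k] by argo
  then show "hankel_det x (n + 1 + k) \<noteq> 0 \<longleftrightarrow> hankel_det_plus (next_seq n x) k \<noteq> 0"
    by (simp add: hankel_det_plus_shift next_seq_def tail_inverse_def hankel_det_uminus)
  have "hankel_det_plus x (n + k) =
      hankel_det (\<lambda>i. if i + 1 < n then 0 else fps_nth ?u (i + 1 - n)) (n + k)"
    unfolding hankel_det_plus_shift
    using assms by (intro hankel_det_cong) (auto simp: first_nonzero_def)
  then have "hankel_det_plus x (n + k) \<noteq> 0 \<longleftrightarrow>
      hankel_det (\<lambda>i. fps_nth (inverse ?u) (n + 1 + i)) k \<noteq> 0"
    using hankel_det_complementary_minor[OF u0, of n k] by argo
  then show "hankel_det_plus x (n + k) \<noteq> 0 \<longleftrightarrow> hankel_det (next_seq n x) k \<noteq> 0"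
    by (simp add: next_seq_def[abs_def] tail_inverse_def hankel_det_uminus)
qed

text \<open>Replacing the last column of the matrix by its image under the null vector \<open>w\<close> of the
  upper rows leaves a single nonzero entry in that column.\<close>

lemma det_last_row_null_vector:
  fixes A :: "nat \<Rightarrow> nat \<Rightarrow> 'a::idom"
  assumes "\<And>r. r < n \<Longrightarrow> (\<Sum>c\<le>n. A r c * w c) = 0"
  shows "det (mat (Suc n) (Suc n) (\<lambda>(r, c). if r = n then x c else A r c)) * w n =
    det (mat n n (\<lambda>(r, c). A r c)) * (\<Sum>c\<le>n. x c * w c)"
proof -
  define M where "M = mat (Suc n) (Suc n) (\<lambda>(r, c). if r = n then x c else A r c)"
  define Y where "Y = mat (Suc n) (Suc n) (\<lambda>(r, c). if c = n then w r else if r = c then 1 else 0)"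
  define P where "P = mat (Suc n) (Suc n) (\<lambda>(r, c). if c = n then
      (if r = n then \<Sum>c\<le>n. x c * w c else 0) else M $$ (r, c))"
  have [simp]: "M \<in> carrier_mat (Suc n) (Suc n)" "Y \<in> carrier_mat (Suc n) (Suc n)"
    "P \<in> carrier_mat (Suc n) (Suc n)"
    by (simp_all add: M_def Y_def P_def)
  have "det Y = prod_list (diag_mat Y)"
    by (rule det_upper_triangular[where n = "Suc n"]) (auto simp: Y_def)
  also have "\<dots> = (\<Prod>i<Suc n. if i = n then w n else 1)"
    by (auto simp: prod_list_diag_prod Y_def atLeast0LessThan intro!: prod.cong)
  finally have detY: "det Y = w n" by simp
  have "M * Y = P"
  proof (intro eq_matI)
    fix r c assume rc: "r < dim_row P" "c < dim_col P"
    then have rc: "r < Suc n" "c < Suc n" by (simp_all add: P_def)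
    have "(M * Y) $$ (r, c) = (\<Sum>t<Suc n. M $$ (r, t) * Y $$ (t, c))"
      using rc by (simp add: scalar_prod_def M_def Y_def atLeast0LessThan)
    also have "\<dots> = P $$ (r, c)"
    proof (cases "c = n")
      case True
      have "(\<Sum>t<Suc n. M $$ (r, t) * Y $$ (t, c)) =
          (\<Sum>t\<le>n. (if r = n then x t else A r t) * w t)"
        unfolding lessThan_Suc_atMost using rc True by (intro sum.cong) (auto simp: M_def Y_def)
      then show ?thesis using rc True assms by (simp add: P_def)
    next
      case False
      have "(\<Sum>t<Suc n. M $$ (r, t) * Y $$ (t, c)) = (\<Sum>t<Suc n. if t = c then M $$ (r, c) else 0)"
        using rc False by (intro sum.cong) (auto simp: Y_def)
      then show ?thesis using rc False by (simp add: P_def)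
    qed
    finally show "(M * Y) $$ (r, c) = P $$ (r, c)" .
  qed (simp_all add: M_def Y_def P_def)
  then have "det P = det M * w n"
    using det_mult[of M "Suc n" Y] detY by simp
  moreover have "det P = (\<Sum>i<Suc n. P $$ (i, n) * cofactor P i n)"
    by (rule laplace_expansion_column) simp_all
  moreover have "\<dots> = (\<Sum>i<Suc n. if i = n then (\<Sum>c\<le>n. x c * w c) * cofactor P n n else 0)"
    by (intro sum.cong) (auto simp: P_def)
  moreover have "cofactor P n n = det (mat n n (\<lambda>(r, c). A r c))"
  proof -
    have "mat_delete P n n = mat n n (\<lambda>(r, c). A r c)"
      by (intro eq_matI) (auto simp: mat_delete_def P_def M_def)
    then show ?thesis by (simp add: cofactor_def)
  qed
  ultimately show ?thesis by (simp add: M_def mult.commute)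
qed

section \<open>Determinant formulas for the atoms\<close>

text \<open>Read backwards, the sum is the convolution of the series with its reciprocal at the
  positive index \<open>r + 1\<close>; the terms with \<open>d > r + 1\<close> contain only
  \<open>x\<close> below index \<open>n\<close>.\<close>

lemma quot_poly_null_vector:
  assumes "first_nonzero x n" "r < n"
  shows "(\<Sum>c\<le>n. x (r + c + 1) * fps_nth (tail_inverse n x) (n - c)) = 0"
proof -
  let ?v = "fps_nth (tail_inverse n x)"
  have "(\<Sum>c\<le>n. x (r + c + 1) * ?v (n - c)) = (\<Sum>d\<le>n. ?v d * x (r + (n - d) + 1))"
    by (rule sum.reindex_bij_witness[where i = "\<lambda>d. n - d" and j = "\<lambda>d. n - d"]) auto
  also have "\<dots> = (\<Sum>d\<le>Suc r. ?v d * x (n + (Suc r - d)))"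
    using assms
    by (intro sum.mono_neutral_cong_right) (auto simp: first_nonzero_def Suc_diff_le add.commute)
  also have "\<dots> = 0"
    using assms(1) by (subst tail_inverse_convolution) (auto simp: first_nonzero_def)
  finally show ?thesis .
qed

text \<open>The coefficient vector of \<open>quot_poly n x\<close> annihilates the rows above the
  last, and its product with the row of powers is the polynomial itself. Its last entry is
  \<open>1 / x n\<close>, whence the factor \<open>x n\<close>.\<close>

lemma det_quot_poly:
  assumes "first_nonzero x n"
  shows "det (mat (Suc n) (Suc n) (\<lambda>(r, c). if r = n then monom 1 c else [:x (r + c + 1):])) =
    smult (x n * hankel_det_plus x n) (quot_poly n x)"
proof -
  let ?v = "fps_nth (tail_inverse n x)"
  let ?M = "mat (Suc n) (Suc n) (\<lambda>(r, c). if r = n then monom 1 c else [:x (r + c + 1):])"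
  interpret const: comm_ring_hom "\<lambda>a::real. [:a:]"
    by unfold_locales (auto simp: one_pCons)
  have xn: "x n \<noteq> 0" using assms by (simp add: first_nonzero_def)
  have "(\<Sum>c\<le>n. [:x (r + c + 1):] * [:?v (n - c):]) = 0" if "r < n" for r
    using quot_poly_null_vector[OF assms that]
    by (simp add: const.hom_sum[symmetric] mult.commute del: sum.lessThan_Suc sum.atMost_Suc)
  then have "det ?M * [:?v (n - n):] = det (mat n n (\<lambda>(r, c). [:x (r + c + 1):])) *
      (\<Sum>c\<le>n. monom 1 c * [:?v (n - c):])"
    by (rule det_last_row_null_vector)
  also have "mat n n (\<lambda>(r, c). [:x (r + c + 1):]) =
      map_mat (\<lambda>a. [:a:]) (mat n n (\<lambda>(r, c). x (r + c + 1)))"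
    by (intro eq_matI) auto
  also have "det \<dots> = [:hankel_det_plus x n:]"
    by (simp add: const.hom_det hankel_det_plus_def)
  also have "(\<Sum>c\<le>n. monom 1 c * [:?v (n - c):]) = quot_poly n x"
    unfolding quot_poly_def by (intro sum.cong) (simp_all add: mult.commute[of "monom _ _"] smult_monom)
  finally have "smult (1 / x n) (det ?M) = smult (hankel_det_plus x n) (quot_poly n x)"
    using xn by (simp add: tail_inverse_0 mult.commute[of "det _"])
  then have "smult (x n) (smult (1 / x n) (det ?M)) =
      smult (x n) (smult (hankel_det_plus x n) (quot_poly n x))"
    by simp
  then show ?thesis using xn by simp
qed

text \<open>The same null vector is applied with the next Hankel row at the bottom. Its product with
  that row is the convolution at \<open>n + 1\<close> lacking the term \<open>d = n + 1\<close>,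
  that is, \<open>x n * next_seq n x 0\<close>.\<close>

lemma hankel_det_plus_Suc:
  assumes "first_nonzero x n"
  shows "hankel_det_plus x (Suc n) = (x n)\<^sup>2 * hankel_det_plus x n * next_seq n x 0"
proof -
  let ?v = "fps_nth (tail_inverse n x)"
  have xn: "x n \<noteq> 0" using assms by (simp add: first_nonzero_def)
  have "mat (Suc n) (Suc n) (\<lambda>(r, c). x (r + c + 1)) =
      mat (Suc n) (Suc n) (\<lambda>(r, c). if r = n then x (n + c + 1) else x (r + c + 1))"
    by (intro eq_matI) auto
  then have "hankel_det_plus x (Suc n) * ?v (n - n) =
      hankel_det_plus x n * (\<Sum>c\<le>n. x (n + c + 1) * ?v (n - c))"
    using det_last_row_null_vector[where A = "\<lambda>r c. x (r + c + 1)" and w = "\<lambda>c. ?v (n - c)",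
        OF quot_poly_null_vector[OF assms]]
    by (simp add: hankel_det_plus_def)
  also have "(\<Sum>c\<le>n. x (n + c + 1) * ?v (n - c)) = (\<Sum>d\<le>n. ?v d * x (n + (Suc n - d)))"
    by (rule sum.reindex_bij_witness[where i = "\<lambda>d. n - d" and j = "\<lambda>d. n - d"]) auto
  also have "\<dots> = x n * next_seq n x 0"
    using tail_inverse_convolution[of x n "Suc n", OF xn] by (simp add: next_seq_def algebra_simps eq_neg_iff_add_eq_0)
  finally show ?thesis
    using xn by (simp add: tail_inverse_0 field_simps power2_eq_square)
qed

text \<open>In the first row only the last entry, \<open>x n\<close>, is nonzero.\<close>

lemma hankel_det_Suc:
  assumes "first_nonzero x n"
  shows "hankel_det x (Suc n) = (-1) ^ n * x n * hankel_det_plus x n"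
proof -
  let ?M = "mat (Suc n) (Suc n) (\<lambda>(i, j). x (i + j))"
  have "hankel_det x (Suc n) = (\<Sum>j<Suc n. ?M $$ (0, j) * cofactor ?M 0 j)"
    unfolding hankel_det_def by (rule laplace_expansion_row) simp_all
  also have "\<dots> = (\<Sum>j<Suc n. if j = n then x n * cofactor ?M 0 n else 0)"
    using assms by (intro sum.cong) (auto simp: first_nonzero_def)
  also have "\<dots> = x n * cofactor ?M 0 n" by simp
  also have "mat_delete ?M 0 n = mat n n (\<lambda>(i, j). x (i + j + 1))"
    by (intro eq_matI) (auto simp: mat_delete_def)
  then have "cofactor ?M 0 n = (-1) ^ n * hankel_det_plus x n"
    by (simp add: cofactor_def hankel_det_plus_def)
  finally show ?thesis by simp
qed

lemma hankel_det_first_nonzero: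
  assumes "first_nonzero x n"
  shows "hankel_det x (Suc n) \<noteq> 0" "hankel_det_plus x n \<noteq> 0"
  using hankel_det_next_seq[OF assms, of 0] by simp_all

text \<open>The zeros written into the determinant are the actual values of the sequence there, and
  by \<open>hankel_det_Suc\<close> the prefactor cancels the factor from
  \<open>det_quot_poly\<close>.\<close>

lemma m_atom_eq_quot_poly:
  assumes "first_nonzero (\<lambda>i. a (int i)) n"
  shows "m_atom a (Suc n) = quot_poly n (\<lambda>i. a (int i))"
proof -
  let ?x = "\<lambda>i. a (int i)"
  have "mat (Suc n) (Suc n) (\<lambda>(r, c). if r = Suc n - 1 then monom 1 c
        else if r + c + 1 < Suc n - 1 then 0 else [:a (int (r + c + 1)):]) =
      mat (Suc n) (Suc n) (\<lambda>(r, c). if r = n then monom 1 c else [:?x (r + c + 1):])"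
    using assms by (intro eq_matI) (auto simp: first_nonzero_def)
  then have "m_atom a (Suc n) = smult ((- 1) ^ (Suc n + 1) / hankel_det ?x (Suc n))
      (smult (?x n * hankel_det_plus ?x n) (quot_poly n ?x))"
    unfolding m_atom_def det_quot_poly[OF assms, symmetric] by simp
  then show ?thesis
    using hankel_det_first_nonzero[OF assms] by (simp add: hankel_det_Suc[OF assms])
qed

text \<open>Reindexed to start at \<open>0\<close>, the even sequence has the plain determinants of
  \<open>b\<close> as its shifted ones, so that \<open>det_quot_poly\<close> applies again.\<close>

lemma l_atom_eq_quot_poly:
  assumes "first_nonzero (\<lambda>i. b (int i - 1)) n" "0 < n"
  shows "l_atom b n = quot_poly n (\<lambda>i. b (int i - 1))"
proof -
  let ?x = "\<lambda>i. b (int i - 1)"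
  have "hankel_det (\<lambda>i. b (int i)) n = hankel_det_plus ?x n"
    by (simp add: hankel_det_plus_shift)
  moreover have "mat (n + 1) (n + 1) (\<lambda>(r, c). if r = n then monom 1 c else [:b (int (r + c)):]) =
      mat (Suc n) (Suc n) (\<lambda>(r, c). if r = n then monom 1 c else [:?x (r + c + 1):])"
    by (intro eq_matI) auto
  ultimately have "l_atom b n = smult (1 / (?x n * hankel_det_plus ?x n))
      (smult (?x n * hankel_det_plus ?x n) (quot_poly n ?x))"
    unfolding l_atom_def det_quot_poly[OF assms(1), symmetric] by simp
  then show ?thesis
    using hankel_det_first_nonzero[OF assms(1)] assms(1) by (simp add: first_nonzero_def)
qed

text \<open>The quotient of the two preceding determinant formulas shows that the two expressions
  for \<open>l\<close> in the case \<open>nu j = mu j\<close> agree. If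
  \<open>next_seq n x 0 = 0\<close>, both sides are divisions by zero and equal
  \<open>0\<close>.\<close>

lemma l_atom_determinant_formula:
  assumes "first_nonzero x n"
  shows "1 / next_seq n x 0 = (- 1) ^ n * x n * hankel_det x (Suc n) / hankel_det_plus x (Suc n)"
  using hankel_det_first_nonzero[OF assms] assms
  unfolding hankel_det_plus_Suc[OF assms] hankel_det_Suc[OF assms] first_nonzero_def
  by (simp add: field_simps power2_eq_square flip: power_mult_distrib)

section \<open>Toeplitz equations as inversion of truncated series\<close>

text \<open>Each entry of the product depends only on \<open>k - i\<close>, so the identity can be
  read off the first row.\<close>

lemma toeplitz_mult_eq_one_iff:
  assumes "length cs = K" "length ds = K"
  shows "toeplitz cs * toeplitz ds = 1\<^sub>m K \<longleftrightarrow>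
    (\<forall>r<K. (\<Sum>d\<le>r. cs ! d * ds ! (r - d)) = (if r = 0 then 1 else 0))"
proof -
  have entry: "(toeplitz cs * toeplitz ds) $$ (i, k) =
      (if i \<le> k then \<Sum>d\<le>k - i. cs ! d * ds ! (k - i - d) else 0)"
    if "i < K" "k < K" for i k
  proof -
    have "(toeplitz cs * toeplitz ds) $$ (i, k) = (\<Sum>t<K. (if i \<le> t then cs ! (t - i) else 0) *
        (if t \<le> k then ds ! (k - t) else 0))"
      using that assms by (simp add: toeplitz_def scalar_prod_def atLeast0LessThan)
    also have "\<dots> = (if i \<le> k then \<Sum>d\<le>k - i. cs ! d * ds ! (k - i - d) else 0)"
      by (rule sum_shifted_convolution[OF that(2)])
    finally show ?thesis .
  qed
  show ?thesis
  proof
    assume eq: "toeplitz cs * toeplitz ds = 1\<^sub>m K"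
    show "\<forall>r<K. (\<Sum>d\<le>r. cs ! d * ds ! (r - d)) = (if r = 0 then 1 else 0)"
    proof (intro allI impI)
      fix r assume "r < K"
      then show "(\<Sum>d\<le>r. cs ! d * ds ! (r - d)) = (if r = 0 then 1 else 0)"
        using entry[of 0 r] by (auto simp: eq)
    qed
  next
    assume conv: "\<forall>r<K. (\<Sum>d\<le>r. cs ! d * ds ! (r - d)) = (if r = 0 then 1 else 0)"
    show "toeplitz cs * toeplitz ds = 1\<^sub>m K"
    proof (rule eq_matI)
      fix i k assume "i < dim_row (1\<^sub>m K :: real mat)" "k < dim_col (1\<^sub>m K :: real mat)"
      then have ik: "i < K" "k < K" by simp_all
      then have "k - i < K" by simp
      then have "(\<Sum>d\<le>k - i. cs ! d * ds ! (k - i - d)) = (if k - i = 0 then 1 else 0)"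
        using conv by blast
      then show "(toeplitz cs * toeplitz ds) $$ (i, k) = 1\<^sub>m K $$ (i, k)"
        unfolding entry[OF ik] using ik by auto
    qed (simp_all add: toeplitz_def assms)
  qed
qed

text \<open>The equation says that the first list holds the initial coefficients of
  \<open>tail_inverse n x\<close>. The coefficients of \<open>quot_poly\<close>, highest first, are
  the first \<open>n + 1\<close> of them by construction; what remains is the condition on
  \<open>y\<close>.\<close>

lemma toeplitz_next_seq_iff:
  assumes "x n \<noteq> 0"
  shows "toeplitz (map (coeff (quot_poly n x)) (rev [0..<n + 1]) @ map (\<lambda>i. - y i) [0..<R]) *
      toeplitz (map (\<lambda>k. x (n + k)) [0..<n + 1 + R]) = 1\<^sub>m (n + 1 + R) \<longleftrightarrow>
    (\<forall>i<R. y i = next_seq n x i)"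
proof -
  define cs where "cs = map (coeff (quot_poly n x)) (rev [0..<n + 1]) @ map (\<lambda>i. - y i) [0..<R]"
  define ds where "ds = map (\<lambda>k. x (n + k)) [0..<n + 1 + R]"
  have len: "length cs = n + 1 + R" "length ds = n + 1 + R" by (simp_all add: cs_def ds_def)
  have ds: "(\<Sum>d\<le>r. cs ! d * ds ! (r - d)) = (\<Sum>d\<le>r. cs ! d * x (n + (r - d)))"
    if "r < n + 1 + R" for r
    using that by (intro sum.cong) (auto simp: ds_def simp del: upt_Suc)
  have "toeplitz cs * toeplitz ds = 1\<^sub>m (n + 1 + R) \<longleftrightarrow>
      (\<forall>r<n + 1 + R. (\<Sum>d\<le>r. cs ! d * x (n + (r - d))) = (if r = 0 then 1 else 0))"
    unfolding toeplitz_mult_eq_one_iff[OF len] by (auto simp: ds)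
  also have "\<dots> \<longleftrightarrow> (\<forall>r<n + 1 + R. cs ! r = fps_nth (tail_inverse n x) r)"
    using assms by (rule tail_inverse_unique)
  also have "\<dots> \<longleftrightarrow> (\<forall>i<R. y i = next_seq n x i)"
  proof -
    have 1: "cs ! r = fps_nth (tail_inverse n x) r" if "r < n + 1" for r
      using that by (simp add: cs_def nth_append rev_nth coeff_quot_poly del: upt_Suc)
    have 2: "cs ! (n + 1 + i) = - y i" if "i < R" for i
      using that by (simp add: cs_def nth_append del: upt_Suc)
    have 3: "- a = b \<longleftrightarrow> a = - b" for a b :: real by auto
    have "(\<forall>r<n + 1 + R. cs ! r = fps_nth (tail_inverse n x) r) \<longleftrightarrow>
        (\<forall>i<R. cs ! (n + 1 + i) = fps_nth (tail_inverse n x) (n + 1 + i))"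
      by (metis 1 add_less_cancel_left le_add_diff_inverse not_less)
    also have "\<dots> \<longleftrightarrow> (\<forall>i<R. y i = next_seq n x i)"
      by (auto simp: 2 3 next_seq_def simp del: One_nat_def add_Suc_right add_Suc)
    finally show ?thesis .
  qed
  finally show ?thesis by (simp only: cs_def ds_def)
qed

lemma map_upto_eq: "map f [lo..hi] = map (\<lambda>k. f (lo + int k)) [0..<nat (hi - lo + 1)]"
  by (intro nth_equalityI) auto

section \<open>Normal indices\<close>

lemma ex_first_nonzero:
  assumes "x k \<noteq> 0"
  obtains n where "first_nonzero x n" "n \<le> k"
proof
  show "first_nonzero x (LEAST n. x n \<noteq> 0)"
    using LeastI[of "\<lambda>n. x n \<noteq> 0", OF assms] by (auto simp: first_nonzero_def dest: not_less_Least)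
  show "(LEAST n. x n \<noteq> 0) \<le> k" using assms by (rule Least_le)
qed

lemma first_nonzero_cong:
  "(\<And>i. i \<le> n \<Longrightarrow> x i = y i) \<Longrightarrow> first_nonzero x n \<longleftrightarrow> first_nonzero y n"
  by (auto simp: first_nonzero_def)

locale normal_enumeration =
  fixes \<s> :: "nat \<Rightarrow> real" and N :: nat and nu mu :: "nat \<Rightarrow> nat"
  assumes N: "1 \<le> N"
    and mu_0: "mu 0 = 0"
    and nu_mono: "strict_mono_on {1..N} nu"
    and nu_image: "nu ` {1..N} = nu_indices \<s> (2 * mu N - 1)"
    and mu_mono: "strict_mono_on {1..N} mu"
    and mu_image: "mu ` {1..N} = mu_indices \<s> (2 * mu N - 1)"
begin

lemma mu_N_pos: "1 \<le> mu N"
proof -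
  have "mu N \<in> mu ` {1..N}" using N by simp
  then show ?thesis unfolding mu_image by (simp add: mu_indices_def normal_indices_def)
qed

text \<open>With last index \<open>2 * mu N - 1\<close>, both truncation conditions,
  \<open>2 * k - 2 \<le> L\<close> here and \<open>2 * k - 1 \<le> L\<close> for \<open>mu\<close>,
  amount to \<open>k \<le> mu N\<close>.\<close>

lemma mem_nu_image_iff: "k \<in> nu ` {1..N} \<longleftrightarrow>
    1 \<le> k \<and> k \<le> mu N \<and> hankel_det \<s> k \<noteq> 0 \<and> hankel_det_plus \<s> (k - 1) \<noteq> 0"
  unfolding nu_image using mu_N_pos by (auto simp: nu_indices_def normal_indices_def)

lemma mem_mu_image_iff: "k \<in> mu ` {1..N} \<longleftrightarrow>
    1 \<le> k \<and> k \<le> mu N \<and> hankel_det \<s> k \<noteq> 0 \<and> hankel_det_plus \<s> k \<noteq> 0"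
  unfolding mu_image using mu_N_pos by (auto simp: mu_indices_def normal_indices_def)

lemma mu_less: "i < j \<Longrightarrow> j \<le> N \<Longrightarrow> mu i < mu j"
proof -
  assume ij: "i < j" "j \<le> N"
  show "mu i < mu j"
  proof (cases "i = 0")
    case True
    have "mu j \<in> mu ` {1..N}" using ij by auto
    then show ?thesis unfolding mem_mu_image_iff using True mu_0 by simp
  next
    case False
    then show ?thesis using ij mu_mono by (auto simp: strict_mono_on_def)
  qed
qed

lemma mu_less_iff: "i \<le> N \<Longrightarrow> j \<le> N \<Longrightarrow> mu i < mu j \<longleftrightarrow> i < j"
  using mu_less by (metis less_irrefl less_trans linorder_neqE_nat)

lemma nu_less_iff: "i \<in> {1..N} \<Longrightarrow> j \<in> {1..N} \<Longrightarrow> nu i < nu j \<longleftrightarrow> i < j"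
  using nu_mono by (rule strict_mono_on_less)

text \<open>The sequence \<open>x\<close> has the Hankel determinants that the odd sequence of the \<open>j\<close>-th step must
  have, up to nonzero factors.\<close>

definition level :: "nat \<Rightarrow> (nat \<Rightarrow> real) \<Rightarrow> bool" where
  "level j x \<longleftrightarrow>
     (\<forall>k. mu (j - 1) + k \<le> mu N \<longrightarrow>
        (hankel_det x k \<noteq> 0 \<longleftrightarrow> hankel_det \<s> (mu (j - 1) + k) \<noteq> 0) \<and>
        (hankel_det_plus x k \<noteq> 0 \<longleftrightarrow> hankel_det_plus \<s> (mu (j - 1) + k) \<noteq> 0)) \<and>
     (\<forall>i\<in>{1..N}. mu (j - 1) < nu i \<longleftrightarrow> j \<le> i)"

lemma level_1:
  assumes "\<And>i. i < 2 * mu N \<Longrightarrow> x i = \<s> i"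
  shows "level 1 x"
proof -
  have "hankel_det x k = hankel_det \<s> k" "hankel_det_plus x k = hankel_det_plus \<s> k"
    if "k \<le> mu N" for k
    using that assms by (auto intro: hankel_det_cong hankel_det_plus_cong)
  moreover have "0 < nu i" if "i \<in> {1..N}" for i
    using imageI[OF that, of nu] unfolding mem_nu_image_iff by simp
  ultimately show ?thesis by (auto simp: level_def mu_0)
qed

text \<open>The first nonzero positions \<open>n\<close> of \<open>x\<close> and \<open>r\<close> of
  its successor are read off first; the determinant equivalences then identify
  \<open>mu (j - 1) + n + 1\<close> with \<open>nu j\<close> and \<open>nu j + r\<close> with
  \<open>mu j\<close>. The last two claims allow sequences that agree with \<open>next_seq\<close>
  only on the range fixed by the recurrence.\<close>

lemma level_step:
  assumes j: "j \<in> {1..N}" and lev: "level j x"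
  shows "mu (j - 1) < nu j" "nu j \<le> mu j"
    and "first_nonzero x (nu j - mu (j - 1) - 1)"
    and "\<And>y. (\<And>i. i < 2 * (mu N - nu j) + 1 \<Longrightarrow> y i = next_seq (nu j - mu (j - 1) - 1) x i) \<Longrightarrow>
      first_nonzero y (mu j - nu j)"
    and "\<And>y x'. (\<And>i. i < 2 * (mu N - nu j) + 1 \<Longrightarrow>
        y i = next_seq (nu j - mu (j - 1) - 1) x i) \<Longrightarrow>
      (\<And>i. i < 2 * (mu N - mu j) \<Longrightarrow> x' i = next_seq (mu j - nu j) y i) \<Longrightarrow>
      level (Suc j) x'"
proof -
  define M where "M = mu (j - 1)"
  define T where "T = mu N"
  have D: "hankel_det x k \<noteq> 0 \<longleftrightarrow> hankel_det \<s> (M + k) \<noteq> 0"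
    and Dp: "hankel_det_plus x k \<noteq> 0 \<longleftrightarrow> hankel_det_plus \<s> (M + k) \<noteq> 0"
    if "M + k \<le> T" for k
    using lev that by (auto simp: level_def M_def T_def)
  have M_less: "M < nu i \<longleftrightarrow> j \<le> i" if "i \<in> {1..N}" for i
    using lev that by (auto simp: level_def M_def)
  have Mj: "M < mu j" using mu_less[of "j - 1" j] j by (simp add: M_def)
  have "mu j \<in> mu ` {1..N}" using j by blast
  then have muj: "mu j \<le> T" "hankel_det \<s> (mu j) \<noteq> 0" "hankel_det_plus \<s> (mu j) \<noteq> 0"
    unfolding mem_mu_image_iff by (simp_all add: T_def)
  \<comment> \<open>As \<open>mu j\<close> is a normal index, the determinant of \<open>x\<close> of
    order \<open>mu j - M\<close> is nonzero. This gives the existence of \<open>n\<close> and keeps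
    it below \<open>mu j - M\<close>; the shifted determinant at \<open>mu j\<close> will do the
    same for \<open>r\<close>.\<close>
  have "\<exists>i < mu j - M. x i \<noteq> 0"
  proof (rule ccontr)
    assume "\<not> ?thesis"
    then have "hankel_det x (mu j - M) = 0"
      using Mj by (intro hankel_det_eq_0) auto
    then show False using D[of "mu j - M"] Mj muj by simp
  qed
  then obtain i where "i < mu j - M" "x i \<noteq> 0" by blast
  moreover from this obtain n where "first_nonzero x n" "n \<le> i"
    using ex_first_nonzero[of x i] by blast
  ultimately have n: "first_nonzero x n" "M + n + 1 \<le> mu j" by simp_all
  define b where "b = next_seq n x"
  have Db: "hankel_det_plus b k \<noteq> 0 \<longleftrightarrow> hankel_det \<s> (M + n + 1 + k) \<noteq> 0"
    if "M + n + 1 + k \<le> T" for k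
    using hankel_det_next_seq(1)[OF n(1), of k] D[of "n + 1 + k"] that
    by (simp add: b_def add.assoc)
  have Dbp: "hankel_det b k \<noteq> 0 \<longleftrightarrow> hankel_det_plus \<s> (M + n + k) \<noteq> 0"
    if "M + n + k \<le> T" for k
    using hankel_det_next_seq(2)[OF n(1), of k] Dp[of "n + k"] that
    by (simp add: b_def add.assoc)
  have "\<exists>i < mu j - (M + n). b i \<noteq> 0"
  proof (rule ccontr)
    assume "\<not> ?thesis"
    then have "hankel_det b (mu j - (M + n)) = 0"
      using n by (intro hankel_det_eq_0) auto
    then show False using Dbp[of "mu j - (M + n)"] n muj by simp
  qed
  then obtain i where "i < mu j - (M + n)" "b i \<noteq> 0" by blast
  moreover from this obtain r where "first_nonzero b r" "r \<le> i"
    using ex_first_nonzero[of b i] by blast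
  ultimately have r: "first_nonzero b r" "M + n + 1 + r \<le> mu j" by simp_all
  define m where "m = M + n + 1 + r"
  have mT: "m \<le> T" using r muj by (simp add: m_def)
  have D_gap: "hankel_det \<s> k = 0" if "M < k" "k < M + n + 1" for k
  proof -
    have "hankel_det x (k - M) = 0"
      using that n by (intro hankel_det_eq_0) (auto simp: first_nonzero_def)
    then show ?thesis using D[of "k - M"] that mT by (simp add: m_def)
  qed
  have Dp_gap: "hankel_det_plus \<s> k = 0" if "M + n + 1 \<le> k" "k < m" for k
  proof -
    have "hankel_det b (k - (M + n)) = 0"
      using that r by (intro hankel_det_eq_0) (auto simp: first_nonzero_def m_def)
    then show ?thesis using Dbp[of "k - (M + n)"] that mT by simp
  qed
  \<comment> \<open>Determinants of order \<open>0\<close> are \<open>1\<close>, so both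
    equivalences for \<open>b\<close> at \<open>k = 0\<close> give nonvanishing.\<close>
  have "M + n + 1 \<in> nu ` {1..N}"
    using Db[of 0] Dbp[of 0] mT unfolding mem_nu_image_iff by (simp add: m_def T_def)
  then obtain i where i: "i \<in> {1..N}" "nu i = M + n + 1" by (metis imageE)
  \<comment> \<open>An index strictly between \<open>M\<close> and \<open>M + n + 1\<close> is
    excluded by \<open>D_gap\<close>, and one above \<open>M + n + 1\<close> up to \<open>m\<close>
    by \<open>Dp_gap\<close> at its predecessor.\<close>
  have nu_cases: "nu i = M + n + 1 \<or> m < nu i" if "i \<in> {1..N}" "j \<le> i" for i
  proof (rule ccontr)
    assume *: "\<not> ?thesis"
    have "nu i \<in> nu ` {1..N}" using that by blast
    then have "hankel_det \<s> (nu i) \<noteq> 0" "hankel_det_plus \<s> (nu i - 1) \<noteq> 0"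
      unfolding mem_nu_image_iff by simp_all
    moreover have "M < nu i" using M_less that by blast
    ultimately show False using * D_gap[of "nu i"] Dp_gap[of "nu i - 1"] by linarith
  qed
  have "j \<le> i" using M_less[OF i(1)] i(2) by simp
  then have "nu j \<le> M + n + 1"
    using nu_less_iff[OF i(1) j] i(2) by (metis not_less)
  then have nuj: "nu j = M + n + 1" using nu_cases[OF j] by (auto simp: m_def)
  \<comment> \<open>At its first nonzero position \<open>r\<close>, \<open>b\<close> has nonzero
    determinants: the plain one of order \<open>r + 1\<close> and the shifted one of order
    \<open>r\<close>. Both translate into determinants of \<open>\<s>\<close> of order
    \<open>m\<close>.\<close>
  have "m \<in> mu ` {1..N}"
    using hankel_det_first_nonzero[OF r(1)] Db[of r] Dbp[of "Suc r"] mT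
    unfolding mem_mu_image_iff by (simp add: m_def T_def)
  then obtain i' where i': "i' \<in> {1..N}" "mu i' = m" by (metis imageE)
  then have "j - 1 < i'" using mu_less_iff[of "j - 1" i'] j by (auto simp: m_def M_def)
  then have "mu j \<le> m"
    using mu_less_iff[of i' j] i' j by force
  then have mj: "mu j = m" using r by (simp add: m_def)
  show "mu (j - 1) < nu j" "nu j \<le> mu j" using nuj mj by (simp_all add: m_def M_def)
  have n_eq: "nu j - mu (j - 1) - 1 = n" and r_eq: "mu j - nu j = r"
    using nuj mj by (simp_all add: M_def m_def)
  show "first_nonzero x (nu j - mu (j - 1) - 1)" using n n_eq by simp
  {
    fix y
    assume y: "\<And>i. i < 2 * (mu N - nu j) + 1 \<Longrightarrow> y i = next_seq (nu j - mu (j - 1) - 1) x i"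
    have yb: "y i = b i" if "i < 2 * (T - nu j) + 1" for i
      using y[unfolded n_eq] that by (simp add: T_def b_def)
    have "first_nonzero y r \<longleftrightarrow> first_nonzero b r"
      using mT by (intro first_nonzero_cong yb) (auto simp: nuj m_def)
    then have fy: "first_nonzero y r" using r by simp
    then show "first_nonzero y (mu j - nu j)" by (simp only: r_eq)
    fix x'
    assume x': "\<And>i. i < 2 * (mu N - mu j) \<Longrightarrow> x' i = next_seq (mu j - nu j) y i"
    have x'y: "x' i = next_seq r y i" if "i < 2 * (T - m)" for i
      using x'[unfolded r_eq] that by (simp add: T_def mj)
    \<comment> \<open>Two successive steps exchange plain and shifted determinants twice, so they
      match those of \<open>\<s>\<close> again, with orders raised by \<open>m\<close>.\<close>
    have "hankel_det x' k \<noteq> 0 \<longleftrightarrow> hankel_det \<s> (m + k) \<noteq> 0"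
      "hankel_det_plus x' k \<noteq> 0 \<longleftrightarrow> hankel_det_plus \<s> (m + k) \<noteq> 0" if k: "m + k \<le> T" for k
    proof -
      have "hankel_det x' k = hankel_det (next_seq r y) k"
        using k by (intro hankel_det_cong x'y) auto
      moreover have "hankel_det_plus y (r + k) = hankel_det_plus b (r + k)"
        using k by (intro hankel_det_plus_cong yb) (auto simp: nuj m_def)
      ultimately show "hankel_det x' k \<noteq> 0 \<longleftrightarrow> hankel_det \<s> (m + k) \<noteq> 0"
        using hankel_det_next_seq(2)[OF fy, of k] Db[of "r + k"] k by (simp add: m_def add.assoc)
      have "hankel_det_plus x' k = hankel_det_plus (next_seq r y) k"
        using k by (intro hankel_det_plus_cong x'y) auto
      moreover have "hankel_det y (r + 1 + k) = hankel_det b (r + 1 + k)"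
        using k by (intro hankel_det_cong yb) (auto simp: nuj m_def)
      ultimately show "hankel_det_plus x' k \<noteq> 0 \<longleftrightarrow> hankel_det_plus \<s> (m + k) \<noteq> 0"
        using hankel_det_next_seq(1)[OF fy, of k] Dbp[of "r + 1 + k"] k
        by (simp add: m_def add.assoc)
    qed
    moreover have "mu j < nu i \<longleftrightarrow> Suc j \<le> i" if "i \<in> {1..N}" for i
    proof
      assume "Suc j \<le> i"
      then have "nu j < nu i" using nu_less_iff[OF j that] by simp
      then show "mu j < nu i" using nu_cases[OF that] \<open>Suc j \<le> i\<close> nuj mj by auto
    next
      assume "mu j < nu i"
      then have "nu j < nu i" using \<open>nu j \<le> mu j\<close> by simp
      then show "Suc j \<le> i" using nu_less_iff[OF j that] by simp
    qed
    ultimately show "level (Suc j) x'"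
      by (simp add: level_def mj T_def)
  }
qed

end

section \<open>Asymptotic expansions of reciprocals\<close>

lemma smallo_transfer:
  assumes "f \<in> o[F](g)" "\<forall>\<^sub>F z in F. f z = f' z" "\<forall>\<^sub>F z in F. g z = g' z"
  shows "f' \<in> o[F](g')"
  using assms(1) landau_o.small.cong_ex[OF assms(2,3)] by simp

lemma poly_tendsto_bigo_1:
  fixes p :: "complex poly"
  assumes "(w \<longlongrightarrow> 0) F"
  shows "((\<lambda>z. poly p (w z)) \<longlongrightarrow> poly p 0) F" "(\<lambda>z. poly p (w z)) \<in> O[F](\<lambda>_. 1)"
proof -
  show *: "((\<lambda>z. poly p (w z)) \<longlongrightarrow> poly p 0) F"
    by (rule isCont_tendsto_compose[OF _ assms]) simp
  show "(\<lambda>z. poly p (w z)) \<in> O[F](\<lambda>_. 1)"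
    by (rule bigoI_tendsto[where c = "poly p 0"]) (use * in auto)
qed

text \<open>With the truncations \<open>p\<close>, \<open>q\<close> of both series,
  \<open>1 / g - q = (1 - p q - (g - p) q) / g\<close>. Here \<open>1 - p q\<close> is divisible by
  the power \<open>K + 1\<close> of \<open>w\<close>, \<open>g - p\<close> is small by assumption,
  and \<open>1 / g\<close> is bounded since \<open>g\<close> tends to
  \<open>u 0 \<noteq> 0\<close>.\<close>

lemma inverse_expansion:
  fixes w g :: "'a \<Rightarrow> complex" and u v :: "nat \<Rightarrow> complex"
  assumes w: "(w \<longlongrightarrow> 0) F"
    and conv: "\<And>r. r \<le> K \<Longrightarrow> (\<Sum>d\<le>r. v d * u (r - d)) = (if r = 0 then 1 else 0)"
    and g: "(\<lambda>z. g z - (\<Sum>k\<le>K. u k * w z ^ k)) \<in> o[F](\<lambda>z. w z ^ K)"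
  shows "\<forall>\<^sub>F z in F. g z \<noteq> 0"
    and "(\<lambda>z. 1 / g z - (\<Sum>k\<le>K. v k * w z ^ k)) \<in> o[F](\<lambda>z. w z ^ K)"
proof -
  define p q where "p = (\<Sum>k\<le>K. monom (u k) k)" and "q = (\<Sum>k\<le>K. monom (v k) k)"
  have p: "poly p y = (\<Sum>k\<le>K. u k * y ^ k)" and q: "poly q y = (\<Sum>k\<le>K. v k * y ^ k)" for y
    by (simp_all add: p_def q_def poly_sum poly_monom)
  have coeff_p: "coeff p k = (if k \<le> K then u k else 0)"
    and coeff_q: "coeff q k = (if k \<le> K then v k else 0)" for k
    by (simp_all add: p_def q_def coeff_sum)
  have g': "(\<lambda>z. g z - poly p (w z)) \<in> o[F](\<lambda>z. w z ^ K)" using g by (simp add: p)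
  have u0: "u 0 \<noteq> 0" using conv[of 0] by auto
  have wK: "(\<lambda>z. w z ^ K) \<in> O[F](\<lambda>_. 1)"
    using poly_tendsto_bigo_1(2)[OF w, of "monom 1 K"] by (simp add: poly_monom)
  have "(\<lambda>z. g z - poly p (w z)) \<in> o[F](\<lambda>_. 1)"
    by (rule landau_o.small_big_trans[OF g' wK])
  then have "((\<lambda>z. g z - poly p (w z)) \<longlongrightarrow> 0) F"
    using smalloD_tendsto by fastforce
  from tendsto_add[OF this poly_tendsto_bigo_1(1)[OF w, of p]]
  have g_lim: "(g \<longlongrightarrow> u 0) F" by (simp add: poly_0_coeff_0 coeff_p)
  then show g_nz: "\<forall>\<^sub>F z in F. g z \<noteq> 0" by (rule tendsto_imp_eventually_ne[OF _ u0])
  have "coeff (1 - p * q) k = 0" if "k \<le> K" for k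
  proof -
    have "coeff (p * q) k = (\<Sum>i\<le>k. v i * u (k - i))"
      using that by (auto simp: mult.commute[of p] coeff_mult coeff_p coeff_q intro!: sum.cong)
    then show ?thesis using conv[OF that] by simp
  qed
  then have "monom 1 (Suc K) dvd 1 - p * q"
    by (simp add: monom_1_dvd_iff' del: coeff_diff)
  then obtain R where R: "1 - p * q = monom 1 (Suc K) * R" by (elim dvdE)
  have "(\<lambda>z. 1 - poly p (w z) * poly q (w z)) \<in> o[F](\<lambda>z. w z ^ K)"
  proof -
    have "1 - poly p (w z) * poly q (w z) = w z ^ K * poly R (w z) * w z" for z
      using arg_cong[OF R, of "\<lambda>p. poly p (w z)"] by (simp add: poly_monom)
    moreover have "(\<lambda>z. w z ^ K * poly R (w z) * w z) \<in> o[F](\<lambda>z. w z ^ K * 1)"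
    proof (rule landau_o.small_1_mult'')
      show "(\<lambda>z. w z ^ K * poly R (w z)) \<in> O[F](\<lambda>z. w z ^ K * 1)"
        by (intro landau_o.big.mult_left poly_tendsto_bigo_1(2)[OF w])
      show "w \<in> o[F](\<lambda>_. 1)" using w by (intro smalloI_tendsto) auto
    qed
    ultimately show ?thesis by simp
  qed
  moreover have "(\<lambda>z. (g z - poly p (w z)) * poly q (w z)) \<in> o[F](\<lambda>z. w z ^ K * 1)"
    by (rule landau_o.small_big_mult[OF g' poly_tendsto_bigo_1(2)[OF w]])
  ultimately have "(\<lambda>z. 1 - poly p (w z) * poly q (w z) - (g z - poly p (w z)) * poly q (w z))
      \<in> o[F](\<lambda>z. w z ^ K)"
    unfolding mult_1_right by (rule sum_in_smallo(2))
  moreover have "(\<lambda>z. 1 / g z) \<in> O[F](\<lambda>_. 1)"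
    using tendsto_divide[OF tendsto_const g_lim u0, of 1] by (intro bigoI_tendsto) auto
  ultimately have "(\<lambda>z. (1 - poly p (w z) * poly q (w z) - (g z - poly p (w z)) * poly q (w z)) * (1 / g z))
      \<in> o[F](\<lambda>z. w z ^ K * 1)"
    by (rule landau_o.small_big_mult)
  then show "(\<lambda>z. 1 / g z - (\<Sum>k\<le>K. v k * w z ^ k)) \<in> o[F](\<lambda>z. w z ^ K)"
  proof (rule smallo_transfer)
    show "\<forall>\<^sub>F z in F. (1 - poly p (w z) * poly q (w z) - (g z - poly p (w z)) * poly q (w z)) * (1 / g z)
        = 1 / g z - (\<Sum>k\<le>K. v k * w z ^ k)"
      using g_nz by eventually_elim (simp add: q[symmetric] field_simps)
  qed simp
qed

lemma shift_expansion:
  fixes Z :: complex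
  assumes "Z \<noteq> 0" "\<And>i. i < n \<Longrightarrow> x i = 0" "n \<le> d"
  shows "Z ^ n * (\<Sum>i\<le>d. x i * inverse Z ^ i) = (\<Sum>k\<le>d - n. x (n + k) * inverse Z ^ k)"
proof -
  have "(\<Sum>i\<le>d. x i * inverse Z ^ i) = (\<Sum>i\<in>{n..d}. x i * inverse Z ^ i)"
    using assms by (intro sum.mono_neutral_right) auto
  also have "\<dots> = (\<Sum>k\<le>d - n. x (n + k) * inverse Z ^ (n + k))"
    using assms(3)
    by (intro sum.reindex_bij_witness[where i = "\<lambda>k. n + k" and j = "\<lambda>i. i - n"]) auto
  finally show ?thesis
    using assms(1) by (simp add: sum_distrib_left power_add field_simps)
qed

text \<open>The terms with \<open>k \<le> n\<close> form the polynomial part, the others the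
  negative powers.\<close>

lemma split_expansion:
  fixes Z :: complex
  assumes "Z \<noteq> 0" "2 * n \<le> d"
  shows "Z ^ n * (\<Sum>k\<le>d - n. v k * inverse Z ^ k) =
    (\<Sum>c\<le>n. v (n - c) * Z ^ c) + (\<Sum>i<d - 2 * n. v (n + 1 + i) * inverse Z ^ (i + 1))"
proof -
  have "{..d - n} = {..n} \<union> {n + 1..d - n}" using assms(2) by auto
  then have "(\<Sum>k\<le>d - n. v k * inverse Z ^ k) =
      (\<Sum>k\<le>n. v k * inverse Z ^ k) + (\<Sum>k\<in>{n + 1..d - n}. v k * inverse Z ^ k)"
    by (simp add: sum.union_disjoint)
  moreover have "Z ^ n * (\<Sum>k\<le>n. v k * inverse Z ^ k) = (\<Sum>c\<le>n. v (n - c) * Z ^ c)"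
  proof -
    have "Z ^ n * (\<Sum>k\<le>n. v k * inverse Z ^ k) = (\<Sum>k\<le>n. v k * Z ^ (n - k))"
      using assms(1) unfolding sum_distrib_left
      by (intro sum.cong) (simp_all add: power_diff field_simps)
    also have "\<dots> = (\<Sum>c\<le>n. v (n - c) * Z ^ c)"
      by (rule sum.reindex_bij_witness[where i = "\<lambda>c. n - c" and j = "\<lambda>c. n - c"]) auto
    finally show ?thesis .
  qed
  moreover have "Z ^ n * (\<Sum>k\<in>{n + 1..d - n}. v k * inverse Z ^ k) =
      (\<Sum>i<d - 2 * n. v (n + 1 + i) * inverse Z ^ (i + 1))"
  proof -
    have "(\<Sum>k\<in>{n + 1..d - n}. v k * inverse Z ^ k) =
        (\<Sum>i<d - 2 * n. v (n + 1 + i) * inverse Z ^ (n + (i + 1)))"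
      using assms(2)
      by (intro sum.reindex_bij_witness[where i = "\<lambda>i. n + 1 + i" and j = "\<lambda>k. k - (n + 1)"]) auto
    then show ?thesis
      using assms(1) by (simp add: sum_distrib_left power_add field_simps)
  qed
  ultimately show ?thesis by (simp add: distrib_left)
qed

lemma poly_quot_poly:
  "poly (map_poly complex_of_real (quot_poly n x)) Z =
    (\<Sum>c\<le>n. complex_of_real (fps_nth (tail_inverse n x) (n - c)) * Z ^ c)"
proof -
  have "map_poly complex_of_real (quot_poly n x) =
      (\<Sum>c\<le>n. monom (complex_of_real (fps_nth (tail_inverse n x) (n - c))) c)"
    by (intro poly_eqI) (simp add: coeff_map_poly coeff_quot_poly coeff_sum)
  then show ?thesis by (simp add: poly_sum poly_monom)
qed

text \<open>Multiplication by \<open>Z^n\<close> gives \<open>f\<close> a nonzero limit; the product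
  is inverted and multiplied by \<open>Z^n\<close> once more. Each multiplication costs
  \<open>n\<close> orders of precision, so \<open>d\<close> drops to
  \<open>d - 2 * n\<close>.\<close>

lemma reciprocal_expansion:
  fixes Z f :: "'a \<Rightarrow> complex"
  assumes Z: "filterlim Z at_infinity F"
    and x: "first_nonzero x n" and d: "2 * n \<le> d"
    and f: "(\<lambda>z. f z - (\<Sum>i\<le>d. of_real (x i) * inverse (Z z) ^ i)) \<in> o[F](\<lambda>z. inverse (Z z) ^ d)"
  shows "\<forall>\<^sub>F z in F. f z \<noteq> 0"
    and "(\<lambda>z. 1 / f z - poly (map_poly of_real (quot_poly n x)) (Z z)
        + (\<Sum>i<d - 2 * n. of_real (next_seq n x i) * inverse (Z z) ^ (i + 1)))
      \<in> o[F](\<lambda>z. inverse (Z z) ^ (d - 2 * n))"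
proof -
  define w where "w = (\<lambda>z. inverse (Z z))"
  define g where "g = (\<lambda>z. Z z ^ n * f z)"
  define u v where "u = (\<lambda>k. complex_of_real (x (n + k)))"
    and "v = (\<lambda>k. complex_of_real (fps_nth (tail_inverse n x) k))"
  have w0: "(w \<longlongrightarrow> 0) F"
    unfolding w_def by (rule filterlim_compose[OF tendsto_inverse_0 Z])
  have Znz: "\<forall>\<^sub>F z in F. Z z \<noteq> 0" by (rule filterlim_at_infinity_imp_eventually_ne[OF Z])
  have conv: "(\<Sum>d\<le>r. v d * u (r - d)) = (if r = 0 then 1 else 0)" for r
  proof -
    have "(\<Sum>d\<le>r. v d * u (r - d)) =
        of_real (\<Sum>d\<le>r. fps_nth (tail_inverse n x) d * x (n + (r - d)))"
      by (simp add: u_def v_def)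
    also have "(\<Sum>d\<le>r. fps_nth (tail_inverse n x) d * x (n + (r - d))) = (if r = 0 then 1 else 0)"
      using x by (intro tail_inverse_convolution) (simp add: first_nonzero_def)
    finally show ?thesis by simp
  qed
  have "(\<lambda>z. Z z ^ n * (f z - (\<Sum>i\<le>d. of_real (x i) * inverse (Z z) ^ i)))
      \<in> o[F](\<lambda>z. Z z ^ n * inverse (Z z) ^ d)"
    by (rule landau_o.small.mult_left[OF f])
  then have g_exp: "(\<lambda>z. g z - (\<Sum>k\<le>d - n. u k * w z ^ k)) \<in> o[F](\<lambda>z. w z ^ (d - n))"
  proof (rule smallo_transfer)
    show "\<forall>\<^sub>F z in F. Z z ^ n * (f z - (\<Sum>i\<le>d. of_real (x i) * inverse (Z z) ^ i)) =
        g z - (\<Sum>k\<le>d - n. u k * w z ^ k)"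
      using Znz
    proof eventually_elim
      case (elim z)
      then show ?case
        using shift_expansion[OF elim, of n "\<lambda>i. complex_of_real (x i)" d] x d
        by (simp add: g_def u_def w_def right_diff_distrib first_nonzero_def)
    qed
    show "\<forall>\<^sub>F z in F. Z z ^ n * inverse (Z z) ^ d = w z ^ (d - n)"
      using Znz by eventually_elim (use d in \<open>simp add: w_def power_diff field_simps\<close>)
  qed
  show f_nz: "\<forall>\<^sub>F z in F. f z \<noteq> 0"
    using inverse_expansion(1)[OF w0 conv g_exp] by eventually_elim (simp add: g_def)
  have "(\<lambda>z. Z z ^ n * (1 / g z - (\<Sum>k\<le>d - n. v k * w z ^ k)))
      \<in> o[F](\<lambda>z. Z z ^ n * w z ^ (d - n))"
    by (intro landau_o.small.mult_left inverse_expansion(2)[OF w0 conv g_exp])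
  then show "(\<lambda>z. 1 / f z - poly (map_poly of_real (quot_poly n x)) (Z z)
        + (\<Sum>i<d - 2 * n. of_real (next_seq n x i) * inverse (Z z) ^ (i + 1)))
      \<in> o[F](\<lambda>z. inverse (Z z) ^ (d - 2 * n))"
  proof (rule smallo_transfer)
    show "\<forall>\<^sub>F z in F. Z z ^ n * (1 / g z - (\<Sum>k\<le>d - n. v k * w z ^ k)) =
        1 / f z - poly (map_poly of_real (quot_poly n x)) (Z z)
        + (\<Sum>i<d - 2 * n. of_real (next_seq n x i) * inverse (Z z) ^ (i + 1))"
      using Znz
    proof eventually_elim
      case (elim z)
      have "Z z ^ n * (1 / g z - (\<Sum>k\<le>d - n. v k * w z ^ k)) =
          1 / f z - Z z ^ n * (\<Sum>k\<le>d - n. v k * inverse (Z z) ^ k)"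
        using elim by (simp add: g_def w_def right_diff_distrib)
      also have "Z z ^ n * (\<Sum>k\<le>d - n. v k * inverse (Z z) ^ k) =
          poly (map_poly of_real (quot_poly n x)) (Z z)
          - (\<Sum>i<d - 2 * n. of_real (next_seq n x i) * inverse (Z z) ^ (i + 1))"
        unfolding split_expansion[OF elim d] poly_quot_poly
        by (simp add: v_def next_seq_def sum_negf)
      finally show ?case by simp
    qed
    show "\<forall>\<^sub>F z in F. Z z ^ n * w z ^ (d - n) = inverse (Z z) ^ (d - 2 * n)"
      using Znz
    proof eventually_elim
      case (elim z)
      have "d - n = n + (d - 2 * n)" using d by simp
      then have "w z ^ (d - n) = w z ^ n * w z ^ (d - 2 * n)" by (metis power_add)
      then show ?case using elim by (simp add: w_def field_simps)
    qed
  qed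
qed

section \<open>The recurrence\<close>

text \<open>One level of the fraction takes two reciprocals, first of \<open>- Z G\<close> and then
  of \<open>E\<close>. The factors \<open>- Z\<close> before and after the first inversion move the
  index by one, so \<open>y\<close> begins at the constant term of \<open>E\<close>. They cost two
  orders and the reciprocals \<open>2 * n\<close> and \<open>2 * r\<close>, which leaves
  \<open>D\<close>.\<close>

lemma continued_fraction_step:
  fixes G Z :: "'a \<Rightarrow> complex" and x y x' :: "nat \<Rightarrow> real"
  assumes Z: "filterlim Z at_infinity F"
    and x: "first_nonzero x n" and y: "first_nonzero y r"
    and y_eq: "\<forall>i\<le>2 * r + D. y i = next_seq n x i"
    and x'_eq: "\<forall>i<D. x' i = next_seq r y i"
    and G: "(\<lambda>z. G z + (\<Sum>i<2 * (n + 1) + 2 * r + D. of_real (x i) * inverse (Z z) ^ (i + 1)))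
      \<in> o[F](\<lambda>z. inverse (Z z) ^ (2 * (n + 1) + 2 * r + D))"
  defines "E \<equiv> \<lambda>z. inverse (G z) + poly (map_poly of_real (quot_poly n x)) (Z z) * Z z"
  shows "\<forall>\<^sub>F z in F. G z \<noteq> 0" "\<forall>\<^sub>F z in F. E z \<noteq> 0"
    and "(\<lambda>z. inverse (E z) - poly (map_poly of_real (quot_poly r y)) (Z z)
        + (\<Sum>i<D. of_real (x' i) * inverse (Z z) ^ (i + 1))) \<in> o[F](\<lambda>z. inverse (Z z) ^ D)"
proof -
  define e where "e = 2 * r + D"
  define d where "d = 2 * n + e + 1"
  define f where "f = (\<lambda>z. - (Z z * G z))"
  have Znz: "\<forall>\<^sub>F z in F. Z z \<noteq> 0" by (rule filterlim_at_infinity_imp_eventually_ne[OF Z])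
  have d_eq: "2 * (n + 1) + 2 * r + D = Suc d" by (simp add: d_def e_def)
  have "(\<lambda>z. Z z * - (G z + (\<Sum>i<Suc d. of_real (x i) * inverse (Z z) ^ (i + 1))))
      \<in> o[F](\<lambda>z. Z z * inverse (Z z) ^ Suc d)"
    using G unfolding d_eq
    by (intro landau_o.small.mult_left) (simp only: landau_o.small.uminus_in_iff)
  then have f: "(\<lambda>z. f z - (\<Sum>i\<le>d. of_real (x i) * inverse (Z z) ^ i)) \<in> o[F](\<lambda>z. inverse (Z z) ^ d)"
  proof (rule smallo_transfer)
    show "\<forall>\<^sub>F z in F. Z z * - (G z + (\<Sum>i<Suc d. of_real (x i) * inverse (Z z) ^ (i + 1))) =
        f z - (\<Sum>i\<le>d. of_real (x i) * inverse (Z z) ^ i)"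
      using Znz
    proof eventually_elim
      case (elim z)
      have "Z z * (\<Sum>i<Suc d. of_real (x i) * inverse (Z z) ^ (i + 1)) =
          (\<Sum>i\<le>d. of_real (x i) * inverse (Z z) ^ i)"
        unfolding sum_distrib_left lessThan_Suc_atMost
        using elim by (intro sum.cong) simp_all
      moreover have "Z z * - (G z + c) = - (Z z * G z) - Z z * c" for c
        by (simp add: algebra_simps)
      ultimately show ?case by (simp only: f_def)
    qed
    show "\<forall>\<^sub>F z in F. Z z * inverse (Z z) ^ Suc d = inverse (Z z) ^ d"
      using Znz by eventually_elim simp
  qed
  have dn: "2 * n \<le> d" and dn': "d - 2 * n = Suc e" by (simp_all add: d_def)
  show "\<forall>\<^sub>F z in F. G z \<noteq> 0"
    using reciprocal_expansion(1)[OF Z x dn f] by eventually_elim (simp add: f_def)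
  have "(\<lambda>z. Z z * - (1 / f z - poly (map_poly of_real (quot_poly n x)) (Z z)
        + (\<Sum>i<Suc e. of_real (next_seq n x i) * inverse (Z z) ^ (i + 1))))
      \<in> o[F](\<lambda>z. Z z * inverse (Z z) ^ Suc e)"
    using reciprocal_expansion(2)[OF Z x dn f] unfolding dn'
    by (intro landau_o.small.mult_left) (simp only: landau_o.small.uminus_in_iff)
  then have E: "(\<lambda>z. E z - (\<Sum>i\<le>e. of_real (y i) * inverse (Z z) ^ i)) \<in> o[F](\<lambda>z. inverse (Z z) ^ e)"
  proof (rule smallo_transfer)
    show "\<forall>\<^sub>F z in F. Z z * - (1 / f z - poly (map_poly of_real (quot_poly n x)) (Z z)
        + (\<Sum>i<Suc e. of_real (next_seq n x i) * inverse (Z z) ^ (i + 1))) =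
        E z - (\<Sum>i\<le>e. of_real (y i) * inverse (Z z) ^ i)"
      using Znz
    proof eventually_elim
      case (elim z)
      have "Z z * (\<Sum>i<Suc e. of_real (next_seq n x i) * inverse (Z z) ^ (i + 1)) =
          (\<Sum>i\<le>e. of_real (y i) * inverse (Z z) ^ i)"
        unfolding sum_distrib_left lessThan_Suc_atMost
        using elim by (intro sum.cong) (simp_all add: y_eq e_def)
      moreover have "Z z * (1 / f z) = - inverse (G z)"
        using elim by (simp add: f_def divide_inverse)
      ultimately show ?case by (simp add: E_def algebra_simps del: sum.lessThan_Suc)
    qed
    show "\<forall>\<^sub>F z in F. Z z * inverse (Z z) ^ Suc e = inverse (Z z) ^ e"
      using Znz by eventually_elim simp
  qed
  have er: "2 * r \<le> e" "e - 2 * r = D" by (simp_all add: e_def)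
  show "\<forall>\<^sub>F z in F. E z \<noteq> 0" by (rule reciprocal_expansion(1)[OF Z y er(1) E])
  have "(\<Sum>i<D. of_real (x' i) * inverse (Z z) ^ (i + 1)) =
      (\<Sum>i<D. of_real (next_seq r y i) * inverse (Z z) ^ (i + 1))" for z
    by (simp add: x'_eq)
  then show "(\<lambda>z. inverse (E z) - poly (map_poly of_real (quot_poly r y)) (Z z)
        + (\<Sum>i<D. of_real (x' i) * inverse (Z z) ^ (i + 1))) \<in> o[F](\<lambda>z. inverse (Z z) ^ D)"
    using reciprocal_expansion(2)[OF Z y er(1) E] unfolding er(2) by (simp add: divide_inverse)
qed

text \<open>\<open>R\<close> counts the terms of the next sequence: for \<open>Lj = 2 n + R\<close>
  the range from \<open>-1\<close> to \<open>Lj - 2 (n + 1)\<close> has \<open>R\<close> members.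
  The \<open>l\<close> version below starts its next sequence at \<open>0\<close> instead.\<close>

lemma m_toeplitz_iff:
  assumes "a (int n) \<noteq> 0" "Lj = int (2 * n + R)"
  defines "x \<equiv> \<lambda>i. a (int i)"
  shows "toeplitz (map (coeff (quot_poly n x)) (rev [0..<Suc n])
        @ map (\<lambda>i. - b i) [-1..Lj - 2 * int (Suc n)]) * toeplitz (map a [int (Suc n) - 1..Lj]) =
      1\<^sub>m (nat (Lj - int (Suc n) + 2)) \<longleftrightarrow> (\<forall>i<R. b (int i - 1) = next_seq n x i)"
proof -
  have 1: "map (\<lambda>i. - b i) [-1..Lj - 2 * int (Suc n)] = map (\<lambda>i. - b (int i - 1)) [0..<R]"
    unfolding map_upto_eq assms(2) by (simp add: algebra_simps)
  have 2: "map a [int (Suc n) - 1..Lj] = map (\<lambda>k. x (n + k)) [0..<n + 1 + R]"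
  proof -
    have "nat (Lj - (int (Suc n) - 1) + 1) = n + 1 + R" by (simp add: assms(2))
    then show ?thesis unfolding map_upto_eq by (simp add: x_def)
  qed
  have 3: "nat (Lj - int (Suc n) + 2) = n + 1 + R" by (simp add: assms(2))
  show ?thesis
    unfolding 1 2 3 using toeplitz_next_seq_iff[of x n "\<lambda>i. b (int i - 1)" R] assms(1)
    by (simp add: x_def)
qed

lemma l_toeplitz_iff:
  assumes "b (int n - 1) \<noteq> 0" "H = int R - 1" "Lj = int (2 * n + R) - 1" "K = n + 1 + R"
  defines "x \<equiv> \<lambda>i. b (int i - 1)"
  shows "toeplitz (map (coeff (quot_poly n x)) (rev [0..<n + 1]) @ map (\<lambda>i. - c i) [0..H])
      * toeplitz (map b [int n - 1..Lj]) = 1\<^sub>m K \<longleftrightarrow> (\<forall>i<R. c (int i) = next_seq n x i)"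
proof -
  have 1: "map (\<lambda>i. - c i) [0..H] = map (\<lambda>i. - c (int i)) [0..<R]"
    unfolding map_upto_eq assms(2) by simp
  have 2: "map b [int n - 1..Lj] = map (\<lambda>k. x (n + k)) [0..<n + 1 + R]"
  proof -
    have "nat (Lj - (int n - 1) + 1) = n + 1 + R" by (simp add: assms(3))
    then show ?thesis unfolding map_upto_eq by (simp add: x_def algebra_simps)
  qed
  show ?thesis
    unfolding 1 2 assms(4) using toeplitz_next_seq_iff[of x n "\<lambda>i. c (int i)" R] assms(1)
    by (simp add: x_def)
qed

definition odd_seq :: "(nat \<Rightarrow> int \<Rightarrow> real) \<Rightarrow> nat \<Rightarrow> nat \<Rightarrow> real" where
  "odd_seq S j i = S (2 * j - 1) (int i)"

definition even_seq :: "(nat \<Rightarrow> int \<Rightarrow> real) \<Rightarrow> nat \<Rightarrow> nat \<Rightarrow> real" where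
  "even_seq S j i = S (2 * j) (int i - 1)"

text \<open>This is the conjunct of \<open>atom_recurrence\<close> for a single \<open>j\<close>,
  isolated so that it can be rewritten one step at a time.\<close>

definition recurrence_step ::
    "nat \<Rightarrow> nat \<Rightarrow> (nat \<Rightarrow> nat) \<Rightarrow> (nat \<Rightarrow> nat) \<Rightarrow> (nat \<Rightarrow> int \<Rightarrow> real)
     \<Rightarrow> (nat \<Rightarrow> real poly) \<Rightarrow> (nat \<Rightarrow> real poly) \<Rightarrow> nat \<Rightarrow> bool" where
  "recurrence_step L N nu mu S m l j \<longleftrightarrow>
     (let \<nu> = nu j - mu (j - 1);
          \<mu> = mu j - nu j;
          Lj = int L - 2 * int (mu (j - 1))
      in
        m j = m_atom (S (2 * j - 1)) \<nu> \<and>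
        toeplitz (map (coeff (m j)) (rev [0..<\<nu>]) @ map (\<lambda>i. - S (2 * j) i) [-1..Lj - 2 * int \<nu>])
          * toeplitz (map (S (2 * j - 1)) [int \<nu> - 1..Lj])
          = 1\<^sub>m (nat (Lj - int \<nu> + 2)) \<and>
        (nu j = mu j \<longrightarrow>
           l j = [: 1 / S (2 * j) (-1) :] \<and>
           l j = [: (-1) ^ (\<nu> + 1) * S (2 * j - 1) (int \<nu> - 1)
                     * hankel_det (\<lambda>i. S (2 * j - 1) (int i)) \<nu>
                     / hankel_det_plus (\<lambda>i. S (2 * j - 1) (int i)) \<nu> :]) \<and>
        (nu j < mu j \<longrightarrow> l j = l_atom (S (2 * j)) \<mu>) \<and>
        (j < N \<longrightarrow>
           toeplitz (map (coeff (l j)) (rev [0..<\<mu> + 1])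
                       @ map (\<lambda>i. - S (2 * j + 1) i) [0..int L - 2 * int (mu j)])
             * toeplitz (map (S (2 * j)) [int \<mu> - 1..Lj - 2 * int \<nu>])
             = 1\<^sub>m (nat (int L - int (mu j) - int (nu j) + 2))))"

lemma atom_recurrence_iff_steps:
  "atom_recurrence L N nu mu \<s> S m l \<longleftrightarrow>
     (\<forall>i\<le>L. odd_seq S 1 i = \<s> i) \<and> (\<forall>j\<in>{1..N}. recurrence_step L N nu mu S m l j)"
  by (simp add: atom_recurrence_def recurrence_step_def odd_seq_def Let_def)

lemma quot_poly_0: "x 0 \<noteq> 0 \<Longrightarrow> quot_poly 0 x = [:1 / x 0:]"
  by (simp add: quot_poly_def tail_inverse_0 monom_0)

context normal_enumeration
begin

text \<open>Once \<open>level\<close> locates the first nonzero terms, determinant formulas and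
  Toeplitz equations all express division of power series. Being an equivalence, it serves both to
  analyse an arbitrary solution of the recurrence and to construct one.\<close>

lemma recurrence_step_iff:
  assumes j: "j \<in> {1..N}" and lev: "level j (odd_seq S j)"
  defines "n \<equiv> nu j - mu (j - 1) - 1" and "r \<equiv> mu j - nu j"
  shows "recurrence_step (2 * mu N - 1) N nu mu S m l j \<longleftrightarrow>
    m j = quot_poly n (odd_seq S j) \<and>
    (\<forall>i<2 * (mu N - nu j) + 1. even_seq S j i = next_seq n (odd_seq S j) i) \<and>
    l j = quot_poly r (even_seq S j) \<and>
    (j < N \<longrightarrow> (\<forall>i<2 * (mu N - mu j). odd_seq S (Suc j) i = next_seq r (even_seq S j) i))"
proof -
  define a b c where "a = S (2 * j - 1)" and "b = S (2 * j)" and "c = S (2 * j + 1)"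
  define x y where "x = odd_seq S j" and "y = even_seq S j"
  define L Lj where "L = 2 * mu N - 1" and "Lj = int L - 2 * int (mu (j - 1))"
  have xa: "x = (\<lambda>i. a (int i))" and yb: "y = (\<lambda>i. b (int i - 1))"
    and x'c: "odd_seq S (Suc j) = (\<lambda>i. c (int i))"
    by (simp_all add: x_def y_def a_def b_def c_def odd_seq_def even_seq_def fun_eq_iff)
  note step = level_step[OF j lev, folded n_def r_def x_def]
  have muj: "mu j \<le> mu N" using mu_less[of j N] j by (cases "j = N") auto
  have nu_Suc: "nu j - mu (j - 1) = Suc n" using step(1) by (simp add: n_def)
  have L: "int L = 2 * int (mu N) - 1" using mu_N_pos by (simp add: L_def)
  have Lj: "Lj = int (2 * n + (2 * (mu N - nu j) + 1))"
    using step(1,2) muj by (simp add: Lj_def L n_def of_nat_diff)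
  define T1 where "T1 q \<longleftrightarrow> toeplitz (map (coeff q) (rev [0..<Suc n])
      @ map (\<lambda>i. - b i) [-1..Lj - 2 * int (Suc n)]) * toeplitz (map a [int (Suc n) - 1..Lj])
      = 1\<^sub>m (nat (Lj - int (Suc n) + 2))" for q
  define T2 where "T2 q \<longleftrightarrow> toeplitz (map (coeff q) (rev [0..<r + 1])
      @ map (\<lambda>i. - c i) [0..int L - 2 * int (mu j)])
      * toeplitz (map b [int r - 1..Lj - 2 * int (Suc n)])
      = 1\<^sub>m (nat (int L - int (mu j) - int (nu j) + 2))" for q
  define l_eq where "l_eq \<longleftrightarrow> (nu j = mu j \<longrightarrow> l j = [: 1 / b (-1) :] \<and>
      l j = [: (-1) ^ (Suc n + 1) * a (int (Suc n) - 1) * hankel_det x (Suc n)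
        / hankel_det_plus x (Suc n) :]) \<and> (nu j < mu j \<longrightarrow> l j = l_atom b r)"
  define next_y where "next_y \<longleftrightarrow> (\<forall>i<2 * (mu N - nu j) + 1. y i = next_seq n x i)"
  have m: "m_atom a (Suc n) = quot_poly n x"
    unfolding xa by (rule m_atom_eq_quot_poly[OF step(3)[unfolded xa]])
  have T1: "T1 (quot_poly n x) \<longleftrightarrow> next_y"
    unfolding T1_def next_y_def xa yb using step(3)[unfolded xa]
    by (intro m_toeplitz_iff Lj) (simp add: first_nonzero_def)
  \<comment> \<open>The first nonzero position of \<open>y\<close> is known only under
    \<open>next_y\<close>, so the equations for \<open>l j\<close> and for the next odd sequence are
    rewritten under that assumption.\<close>
  have l: "l_eq \<longleftrightarrow> l j = quot_poly r y" if next_y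
  proof -
    have fy: "first_nonzero y r" using step(4)[of y] that by (simp add: next_y_def)
    show ?thesis
    proof (cases "nu j = mu j")
      case True
      then have y0: "y 0 \<noteq> 0" and r0: "r = 0" using fy by (simp_all add: r_def first_nonzero_def)
      have "y 0 = next_seq n x 0" using that by (simp add: next_y_def)
      then have "1 / y 0 = (- 1) ^ n * x n * hankel_det x (Suc n) / hankel_det_plus x (Suc n)"
        using l_atom_determinant_formula[OF step(3)] by simp
      then show ?thesis using True y0 r0 by (simp add: l_eq_def quot_poly_0 xa yb)
    next
      case False
      then have "nu j < mu j" "0 < r" using step(2) by (simp_all add: r_def)
      then show ?thesis
        using l_atom_eq_quot_poly[OF fy[unfolded yb]] by (simp add: l_eq_def yb)
    qed
  qed
  have T2: "T2 (quot_poly r y) \<longleftrightarrow>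
      (\<forall>i<2 * (mu N - mu j). odd_seq S (Suc j) i = next_seq r y i)" if next_y
  proof -
    have "first_nonzero y r" using step(4)[of y] that by (simp add: next_y_def)
    moreover have "int L - 2 * int (mu j) = int (2 * (mu N - mu j)) - 1"
      using muj by (simp add: L of_nat_diff)
    moreover have "Lj - 2 * int (Suc n) = int (2 * r + 2 * (mu N - mu j)) - 1"
      using muj step(2) by (simp add: Lj r_def of_nat_diff)
    moreover have "nat (int L - int (mu j) - int (nu j) + 2) = r + 1 + 2 * (mu N - mu j)"
      using muj step(2) by (simp add: L r_def)
    ultimately show ?thesis
      unfolding T2_def yb x'c by (intro l_toeplitz_iff) (simp_all add: first_nonzero_def)
  qed
  have "recurrence_step L N nu mu S m l j \<longleftrightarrow>
      m j = m_atom a (Suc n) \<and> T1 (m j) \<and> l_eq \<and> (j < N \<longrightarrow> T2 (l j))"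
    unfolding recurrence_step_def Let_def nu_Suc T1_def T2_def l_eq_def xa
      a_def[symmetric] b_def[symmetric] c_def[symmetric] r_def[symmetric] Lj_def[symmetric]
    by (simp only: conj_assoc)
  also have "\<dots> \<longleftrightarrow> m j = quot_poly n x \<and> next_y \<and> l j = quot_poly r y \<and>
      (j < N \<longrightarrow> (\<forall>i<2 * (mu N - mu j). odd_seq S (Suc j) i = next_seq r y i))"
    using m T1 l T2 by metis
  finally show ?thesis by (simp only: L_def x_def y_def next_y_def)
qed

text \<open>The recurrence fixes only finitely many terms of each sequence, but these are the ones
  on which \<open>level\<close> depends, so it propagates by \<open>level_step\<close>.\<close>

lemma level_if_recurrence:
  assumes rec: "atom_recurrence (2 * mu N - 1) N nu mu \<s> S m l" and "j \<in> {1..N}"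
  shows "level j (odd_seq S j)"
  using assms(2)
proof (induction j)
  case (Suc j)
  show ?case
  proof (cases "j = 0")
    case True
    have "odd_seq S 1 i = \<s> i" if "i < 2 * mu N" for i
      using rec that by (auto simp: atom_recurrence_iff_steps)
    then show ?thesis using level_1 True by simp
  next
    case False
    then have j: "j \<in> {1..N}" "j < N" using Suc.prems by auto
    have lev: "level j (odd_seq S j)" using Suc.IH j by blast
    have "recurrence_step (2 * mu N - 1) N nu mu S m l j"
      using rec j by (simp add: atom_recurrence_iff_steps)
    then show ?thesis
      unfolding recurrence_step_iff[OF j(1) lev] using j(2)
      by (intro level_step(5)[OF j(1) lev, of "even_seq S j"]) blast+
  qed
qed simp

section \<open>Solvability of the recurrence\<close>

text \<open>These are the odd sequences \<open>S (2 * j + 1)\<close> of a solution, continued beyond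
  the truncation.\<close>

primrec canonical_seq :: "nat \<Rightarrow> nat \<Rightarrow> real" where
  "canonical_seq 0 = \<s>"
| "canonical_seq (Suc j) = next_seq (mu (Suc j) - nu (Suc j))
     (next_seq (nu (Suc j) - mu j - 1) (canonical_seq j))"

lemma ex_atom_recurrence: "\<exists>S m l. atom_recurrence (2 * mu N - 1) N nu mu \<s> S m l"
proof -
  define b where "b j = next_seq (nu j - mu (j - 1) - 1) (canonical_seq (j - 1))" for j
  \<comment> \<open>Order \<open>2 * j - 1\<close> halves to \<open>j - 1\<close>; in even order the
    argument \<open>i + 1\<close> undoes the start at \<open>-1\<close>. Below the index range
    \<open>nat\<close> repeats the first term.\<close>
  define S where "S k i = (if odd k then canonical_seq (k div 2) (nat i) else b (k div 2) (nat (i + 1)))"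
    for k i
  define m where "m j = quot_poly (nu j - mu (j - 1) - 1) (canonical_seq (j - 1))" for j
  define l where "l j = quot_poly (mu j - nu j) (b j)" for j
  have odd: "odd_seq S j = canonical_seq (j - 1)" if "1 \<le> j" for j
  proof -
    have "odd (2 * j - 1)" "(2 * j - 1) div 2 = j - 1" using that by presburger+
    then show ?thesis by (simp add: odd_seq_def S_def fun_eq_iff)
  qed
  have even: "even_seq S j = b j" for j
    by (simp add: even_seq_def S_def fun_eq_iff)
  have lev: "level (Suc j) (canonical_seq j)" if "j < N" for j
    using that
  proof (induction j)
    case 0
    show ?case using level_1[of \<s>] by simp
  next
    case (Suc j)
    then show ?case
      by (intro level_step(5)[of "Suc j" "canonical_seq j"]) auto
  qed
  have "recurrence_step (2 * mu N - 1) N nu mu S m l j" if j: "j \<in> {1..N}" for j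
  proof -
    have odd_j: "odd_seq S j = canonical_seq (j - 1)" using odd j by simp
    moreover have "canonical_seq j = next_seq (mu j - nu j) (b j)"
      using j by (cases j) (simp_all add: b_def)
    moreover have "level j (odd_seq S j)"
    proof -
      have "j - 1 < N" "Suc (j - 1) = j" using j by auto
      then show ?thesis using lev[of "j - 1"] by (simp only: odd_j)
    qed
    ultimately show ?thesis
      using recurrence_step_iff[OF j, of S m l] odd[of "Suc j"] by (simp add: even m_def l_def b_def)
  qed
  moreover have "odd_seq S 1 i = \<s> i" for i using odd[of 1] by simp
  ultimately show ?thesis unfolding atom_recurrence_iff_steps by blast
qed

end

section \<open>Continued fractions\<close>

text \<open>Solving \<open>R_j = 1 / (- m z + 1 / (l + R_(j+1)))\<close> for the tail gives this
  recursion; the parameter \<open>\<tau>\<close> will be the remainder after \<open>N\<close>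
  levels.\<close>

primrec cfrac_remainder :: "(nat \<Rightarrow> real poly) \<Rightarrow> (nat \<Rightarrow> real poly) \<Rightarrow>
    (('n::finite \<Rightarrow> complex) \<Rightarrow> complex) \<Rightarrow> nat \<Rightarrow> ('n \<Rightarrow> complex) \<Rightarrow> complex" where
  "cfrac_remainder m l G 0 z = G z"
| "cfrac_remainder m l G (Suc j) z =
     inverse (inverse (cfrac_remainder m l G j z) + atom_at (m (Suc j)) z * (\<Prod>i\<in>UNIV. z i))
     - atom_at (l (Suc j)) z"

text \<open>With the convention \<open>1 / 0 = 0\<close> inversion is an involution on all of the complex numbers, so
  no regularity is needed here.\<close>

lemma cfrac_from_remainder:
  assumes "j \<le> N"
  shows "cfrac_from m l N z (cfrac_remainder m l G N z) (Suc j) = cfrac_remainder m l G j z"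
  using assms
proof (induction rule: inc_induct)
  case (step j)
  have "[Suc j..<N + 1] = Suc j # [Suc (Suc j)..<N + 1]"
    using step.hyps by (intro upt_conv_Cons) simp
  then have "cfrac_from m l N z t (Suc j) =
      1 / (- atom_at (m (Suc j)) z * (\<Prod>i\<in>UNIV. z i)
        + 1 / (atom_at (l (Suc j)) z + cfrac_from m l N z t (Suc (Suc j))))" for t
    by (simp add: cfrac_from_def del: upt_Suc)
  then show ?case using step.IH by (simp add: divide_inverse)
qed (simp add: cfrac_from_def)

text \<open>With remainder \<open>R\<close> before a level, its two denominators are
  \<open>1 / (1 / R + m z)\<close> and \<open>1 / R\<close>.\<close>

lemma cfrac_regular_remainder:
  assumes "\<And>j. j < N \<Longrightarrow> cfrac_remainder m l G j z \<noteq> 0 \<and>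
    inverse (cfrac_remainder m l G j z) + atom_at (m (Suc j)) z * (\<Prod>i\<in>UNIV. z i) \<noteq> 0"
  shows "cfrac_regular m l N z (cfrac_remainder m l G N z)"
  unfolding cfrac_regular_def
proof
  fix j assume "j \<in> {1..N}"
  then obtain i where i: "j = Suc i" "i < N" by (cases j) auto
  then have "cfrac_from m l N z (cfrac_remainder m l G N z) (j + 1) = cfrac_remainder m l G (Suc i) z"
    using cfrac_from_remainder[of "Suc i" N] by simp
  then show "atom_at (l j) z + cfrac_from m l N z (cfrac_remainder m l G N z) (j + 1) \<noteq> 0 \<and>
      - atom_at (m j) z * (\<Prod>i\<in>UNIV. z i)
      + 1 / (atom_at (l j) z + cfrac_from m l N z (cfrac_remainder m l G N z) (j + 1)) \<noteq> 0"
    using assms[OF i(2)] by (simp add: i divide_inverse)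
qed

text \<open>By induction the \<open>j\<close>-th remainder has an expansion with coefficients
  \<open>odd_seq S (Suc j)\<close>, up to order \<open>2 * (mu N - mu j)\<close>. At
  \<open>j = N\<close> the sum is empty and the order is \<open>0\<close>, which is the claim
  \<open>o(1)\<close>.\<close>

lemma (in normal_enumeration) cfrac_remainder_expansion:
  fixes G :: "('n::finite \<Rightarrow> complex) \<Rightarrow> complex"
  defines "Z \<equiv> \<lambda>z :: 'n \<Rightarrow> complex. \<Prod>i\<in>UNIV. z i"
  assumes rec: "atom_recurrence (2 * mu N - 1) N nu mu \<s> S m l"
    and Z: "filterlim Z at_infinity F"
    and G: "(\<lambda>z. G z + (\<Sum>i<2 * mu N. of_real (\<s> i) * inverse (Z z) ^ (i + 1)))
      \<in> o[F](\<lambda>z. inverse (Z z) ^ (2 * mu N))"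
  shows "\<forall>\<^sub>F z in F. cfrac_regular m l N z (cfrac_remainder m l G N z)"
    and "cfrac_remainder m l G N \<in> o[F](\<lambda>_. 1)"
proof -
  let ?R = "cfrac_remainder m l G"
  define expansion where "expansion j \<longleftrightarrow>
    (\<lambda>z. ?R j z + (\<Sum>i<2 * (mu N - mu j). of_real (odd_seq S (Suc j) i) * inverse (Z z) ^ (i + 1)))
      \<in> o[F](\<lambda>z. inverse (Z z) ^ (2 * (mu N - mu j)))" for j
  have step: "(\<forall>\<^sub>F z in F. ?R j z \<noteq> 0 \<and> inverse (?R j z) + atom_at (m (Suc j)) z * Z z \<noteq> 0) \<and>
      expansion (Suc j)" if exp_j: "expansion j" and "j < N" for j
  proof -
    have J: "Suc j \<in> {1..N}" using that by simp
    note lev = level_if_recurrence[OF rec J]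
    define x y where "x = odd_seq S (Suc j)" and "y = even_seq S (Suc j)"
    define n r D where "n = nu (Suc j) - mu j - 1" and "r = mu (Suc j) - nu (Suc j)"
      and "D = 2 * (mu N - mu (Suc j))"
    have "recurrence_step (2 * mu N - 1) N nu mu S m l (Suc j)"
      using rec J by (simp add: atom_recurrence_iff_steps)
    then have m: "m (Suc j) = quot_poly n x"
      and y: "\<And>i. i < 2 * (mu N - nu (Suc j)) + 1 \<Longrightarrow> y i = next_seq n x i"
      and l: "l (Suc j) = quot_poly r y"
      and x': "\<And>i. Suc j < N \<Longrightarrow> i < D \<Longrightarrow> odd_seq S (Suc (Suc j)) i = next_seq r y i"
      unfolding recurrence_step_iff[OF J lev] by (simp_all add: n_def r_def x_def y_def D_def)
    note gaps = level_step[OF J lev, unfolded diff_Suc_1, folded n_def r_def x_def]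
    have muJ: "mu (Suc j) \<le> mu N" using mu_less[of "Suc j" N] that by (cases "Suc j = N") auto
    have deg: "2 * (mu N - mu j) = 2 * (n + 1) + 2 * r + D"
      and deg': "2 * r + D = 2 * (mu N - nu (Suc j))"
      using gaps(1,2) muJ by (simp_all add: n_def r_def D_def)
    have fy: "first_nonzero y r" using y by (rule gaps(4))
    have y_eq: "\<forall>i\<le>2 * r + D. y i = next_seq n x i"
      using y by (simp add: deg')
    \<comment> \<open>After the last level the recurrence prescribes no further odd sequence, but
      then \<open>D = 0\<close>.\<close>
    have x'_eq: "\<forall>i<D. odd_seq S (Suc (Suc j)) i = next_seq r y i"
      using x' \<open>j < N\<close> by (cases "Suc j = N") (auto simp: D_def)
    note cf = continued_fraction_step[OF Z gaps(3) fy y_eq x'_eq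
        exp_j[unfolded expansion_def deg, folded x_def], folded m l]
    have "expansion (Suc j)"
      using cf(3) by (simp add: expansion_def D_def atom_at_def Z_def)
    moreover have "\<forall>\<^sub>F z in F. ?R j z \<noteq> 0 \<and> inverse (?R j z) + atom_at (m (Suc j)) z * Z z \<noteq> 0"
      using cf(1,2) by eventually_elim (simp add: atom_at_def Z_def)
    ultimately show ?thesis by blast
  qed
  have "\<s> i = odd_seq S 1 i" if "i < 2 * mu N" for i
    using rec that by (auto simp: atom_recurrence_iff_steps)
  then have "expansion 0"
    using G by (simp add: expansion_def mu_0)
  then have exp: "expansion j" if "j \<le> N" for j
    using that by (induction j) (auto dest: step)
  have "\<forall>\<^sub>F z in F. \<forall>j\<in>{..<N}. ?R j z \<noteq> 0 \<and> inverse (?R j z) + atom_at (m (Suc j)) z * Z z \<noteq> 0"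
    using step exp by (intro eventually_ball_finite) auto
  then show "\<forall>\<^sub>F z in F. cfrac_regular m l N z (?R N z)"
    by eventually_elim (rule cfrac_regular_remainder, auto simp: Z_def)
  show "?R N \<in> o[F](\<lambda>_. 1)" using exp[of N] by (simp add: expansion_def)
qed

section \<open>Expansions of solutions in sectors\<close>

lemma filterlim_coordinate_at_infinity_sector:
  "filterlim (\<lambda>z. z i) at_infinity (at_infinity_sector \<epsilon>)"
  unfolding filterlim_iff_le_filtercomap at_infinity_sector_def
  by (rule INF_lower2[of i]) (auto intro: filtercomap_mono)

lemma filterlim_prod_at_infinity_sector:
  "filterlim (\<lambda>z :: 'n::finite \<Rightarrow> complex. \<Prod>i\<in>UNIV. z i) at_infinity (at_infinity_sector \<epsilon>)"
proof -
  have "filterlim (\<lambda>z :: 'n \<Rightarrow> complex. \<Prod>i\<in>A. z i) at_infinity (at_infinity_sector \<epsilon>)"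
    if "finite A" "A \<noteq> {}" for A
    using that
  proof (induction rule: finite_ne_induct)
    case (singleton i)
    then show ?case by (simp add: filterlim_coordinate_at_infinity_sector)
  next
    case (insert i A)
    then show ?case
      by (simp add: filterlim_at_infinity_times filterlim_coordinate_at_infinity_sector)
  qed
  then show ?thesis by simp
qed

text \<open>Multiplying by the monomial \<open>z^p\<close>, which is eventually nonzero because
  every coordinate tends to infinity, reduces the problem to the single variable given by the
  product of the coordinates.\<close>

lemma MP_solution_expansion:
  fixes p :: "'n::finite \<Rightarrow> nat"
  assumes "MP_solution p s L F" "0 < \<epsilon>"
  shows "(\<lambda>z. F z * (\<Prod>i\<in>UNIV. z i ^ p i)
      + (\<Sum>i<L + 1. of_real (associated_seq p s i) * inverse (\<Prod>i\<in>UNIV. z i) ^ (i + 1)))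
    \<in> o[at_infinity_sector \<epsilon>](\<lambda>z. inverse (\<Prod>i\<in>UNIV. z i) ^ (L + 1))"
proof -
  let ?P = "\<lambda>z :: 'n \<Rightarrow> complex. \<Prod>i\<in>UNIV. z i ^ p i"
  let ?Z = "\<lambda>z :: 'n \<Rightarrow> complex. \<Prod>i\<in>UNIV. z i"
  have "\<forall>\<^sub>F z :: 'n \<Rightarrow> complex in at_infinity_sector \<epsilon>. \<forall>i. z i \<noteq> 0"
    by (intro eventually_all_finite
        filterlim_at_infinity_imp_eventually_ne[OF filterlim_coordinate_at_infinity_sector])
  then have Pnz: "\<forall>\<^sub>F z in at_infinity_sector \<epsilon>. ?P z \<noteq> 0"
    by eventually_elim simp
  have "(\<lambda>z. ?P z * (F z - 1 / ?P z *
      (\<Sum>j\<le>L. - complex_of_real (associated_seq p s j) / ?Z z ^ (j + 1))))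
    \<in> o[at_infinity_sector \<epsilon>](\<lambda>z. ?P z * (1 / ?P z * (1 / ?Z z ^ (L + 1))))"
    using assms unfolding MP_solution_def by (intro landau_o.small.mult_left) blast
  then show ?thesis
  proof (rule smallo_transfer)
    show "\<forall>\<^sub>F z in at_infinity_sector \<epsilon>. ?P z * (F z - 1 / ?P z *
        (\<Sum>j\<le>L. - complex_of_real (associated_seq p s j) / ?Z z ^ (j + 1))) =
      F z * ?P z + (\<Sum>i<L + 1. of_real (associated_seq p s i) * inverse (?Z z) ^ (i + 1))"
      using Pnz
    proof eventually_elim
      case (elim z)
      have "(\<Sum>j\<le>L. - complex_of_real (associated_seq p s j) / ?Z z ^ (j + 1)) =
          - (\<Sum>i<L + 1. of_real (associated_seq p s i) * inverse (?Z z) ^ (i + 1))"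
        unfolding Suc_eq_plus1[symmetric] lessThan_Suc_atMost sum_negf[symmetric]
        by (intro sum.cong) (simp_all add: divide_inverse power_inverse)
      moreover have "P * (c - 1 / P * - b) = c * P + b" if "P \<noteq> 0" for P b c :: complex
        using that by (simp add: field_simps)
      ultimately show ?case using elim by (simp only:)
    qed
    show "\<forall>\<^sub>F z in at_infinity_sector \<epsilon>. ?P z * (1 / ?P z * (1 / ?Z z ^ (L + 1))) =
        inverse (?Z z) ^ (L + 1)"
      using Pnz by eventually_elim (simp add: divide_inverse power_inverse del: power_Suc)
  qed
qed

text \<open>The first conjunct keeps the second from being vacuous. One function
  \<open>\<tau>\<close> serves all sectors; the identity holds wherever no coordinate vanishes,
  under the convention \<open>1 / 0 = 0\<close>, and regularity makes it a genuine continued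
  fraction near infinity in each sector.\<close>

theorem proposition3p8:
  fixes p :: "'n::finite \<Rightarrow> nat"
    and s :: "('n \<Rightarrow> nat) \<Rightarrow> real"
    and N :: nat
    and nu mu :: "nat \<Rightarrow> nat"
    and F :: "('n \<Rightarrow> complex) \<Rightarrow> complex"
  defines "\<s> \<equiv> associated_seq p s"
    and "L \<equiv> 2 * mu N - 1"
  assumes "\<exists>k. p k = 0"
    and "\<And>i. (\<nexists>j. i = (\<lambda>k. p k + j)) \<Longrightarrow> s i = 0"
    and "1 \<le> N"
    and "mu 0 = 0"
    and "strict_mono_on {1..N} nu" and "nu ` {1..N} = nu_indices \<s> L"
    and "strict_mono_on {1..N} mu" and "mu ` {1..N} = mu_indices \<s> L"
    and "normal_indices \<s> L = nu ` {1..N} \<union> mu ` {1..N}"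
    and "MP_solution p s L F"
  shows "(\<exists>S m l. atom_recurrence L N nu mu \<s> S m l) \<and>
    (\<forall>S m l. atom_recurrence L N nu mu \<s> S m l \<longrightarrow>
      (\<exists>\<tau> :: ('n \<Rightarrow> complex) \<Rightarrow> complex.
         (\<forall>z. (\<forall>i. z i \<noteq> 0) \<longrightarrow>
            F z = 1 / (\<Prod>i\<in>UNIV. z i ^ p i) * cfrac_from m l N z (\<tau> z) 1) \<and>
         (\<forall>\<epsilon>>0. (\<forall>\<^sub>F z in at_infinity_sector \<epsilon>. cfrac_regular m l N z (\<tau> z)) \<and>
                 \<tau> \<in> o[at_infinity_sector \<epsilon>](\<lambda>_. 1))))"
proof -
  interpret normal_enumeration \<s> N nu mu
    by unfold_locales (use assms in simp_all)
  \<comment> \<open>The natural subtraction in \<open>L\<close> does not truncate, as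
    \<open>mu N\<close> is positive.\<close>
  have L: "L + 1 = 2 * mu N" using mu_N_pos by (simp add: L_def)
  show ?thesis
  proof (intro conjI allI impI)
    show "\<exists>S m l. atom_recurrence L N nu mu \<s> S m l"
      unfolding L_def by (rule ex_atom_recurrence)
  next
    fix S m l assume rec: "atom_recurrence L N nu mu \<s> S m l"
    define G where "G z = F z * (\<Prod>i\<in>UNIV. z i ^ p i)" for z
    have "(\<lambda>z. G z + (\<Sum>i<2 * mu N. of_real (\<s> i) * inverse (\<Prod>i\<in>UNIV. z i) ^ (i + 1)))
        \<in> o[at_infinity_sector \<epsilon>](\<lambda>z. inverse (\<Prod>i\<in>UNIV. z i) ^ (2 * mu N))" if "0 < \<epsilon>" for \<epsilon>
      using MP_solution_expansion[OF assms(12) that] unfolding L G_def \<s>_def .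
    note expansion = cfrac_remainder_expansion[OF rec[unfolded L_def]
        filterlim_prod_at_infinity_sector this]
    have "F z = 1 / (\<Prod>i\<in>UNIV. z i ^ p i) * cfrac_from m l N z (cfrac_remainder m l G N z) 1"
      if "\<forall>i. z i \<noteq> 0" for z
      using cfrac_from_remainder[of 0 N m l z G] that by (simp add: G_def)
    with expansion show "\<exists>\<tau> :: ('n \<Rightarrow> complex) \<Rightarrow> complex.
         (\<forall>z. (\<forall>i. z i \<noteq> 0) \<longrightarrow>
            F z = 1 / (\<Prod>i\<in>UNIV. z i ^ p i) * cfrac_from m l N z (\<tau> z) 1) \<and>
         (\<forall>\<epsilon>>0. (\<forall>\<^sub>F z in at_infinity_sector \<epsilon>. cfrac_regular m l N z (\<tau> z)) \<and>
                 \<tau> \<in> o[at_infinity_sector \<epsilon>](\<lambda>_. 1))"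
      by (intro exI[of _ "cfrac_remainder m l G N"]) blast
  qed
qed

end
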